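(* Let $0<\beta<3$ and let $\rho$ be a non-negative Schwartz function on $\mathbb{R}^3$ such that $(\mathcal{F}^{-1}\rho)(\xi)\ge0$ for all $\xi\in\mathbb{R}^3$. Let $f(x)=\left(\rho*\frac{1}{|\cdot|^{\beta}}\right)(x)$, $x\in\mathbb{R}^3$, and let $\mu$ be the spectral measure of $f$. Then for every $\gamma$ with $0<\gamma<\min\left(\frac{3-\beta}{2},1\right)$, the Fourier transform of the tempered measure $|\zeta|^{2\gamma}\mu(d\zeta)$ is a non-negative locally integrable function, and $$\int_{\mathbb{R}^3}\frac{\mu(d\zeta)}{1+|\zeta|^{2-2\gamma}}<\infty.$$
   Context: $\mathcal{F}\varphi(\xi)=\int_{\mathbb{R}^3}\varphi(x)e^{-i\xi\cdot x}dx$. The spectral measure $\mu$ of a non-negative, non-negative definite, locally integrable tempered function $f$ is the non-negative tempered measure with $\int f(x)\varphi(x)\,dx=\int\mathcal{F}\varphi(\xi)\,\mu(d\xi)$ for all $\varphi\in\mathcal{S}(\mathbb{R}^3)$. The Fourier transform of a tempered measure $\nu$ is the function $g$ if $\int g\varphi\,dx=\int\mathcal{F}\varphi\,d\nu$ for all $\varphi\in\mathcal{S}(\mathbb{R}^3)$. *)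

theory Defs
  imports "HOL-Analysis.Analysis"
begin

primrec partials ::
    "'a::euclidean_space list \<Rightarrow> ('a \<Rightarrow> 'b::real_normed_vector) \<Rightarrow> 'a \<Rightarrow> 'b" where
  "partials [] u = u"
| "partials (b # bs) u = (\<lambda>x. frechet_derivative (partials bs u) (at x) b)"

text \<open>
  Total differentiability of every iterated partial derivative amounts to smoothness, and it
  ensures that \<open>frechet_derivative\<close> above is never applied to a non-differentiable function.
\<close>

definition schwartz :: "('a::euclidean_space \<Rightarrow> 'b::real_normed_vector) \<Rightarrow> bool" where
  "schwartz u \<longleftrightarrow>
     (\<forall>bs. set bs \<subseteq> Basis \<longrightarrow>
        (\<forall>x. partials bs u differentiable (at x)) \<and>
        (\<forall>k::nat. bounded (range (\<lambda>x. norm x ^ k *\<^sub>R partials bs u x))))"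

definition fourier :: "('a::euclidean_space \<Rightarrow> complex) \<Rightarrow> 'a \<Rightarrow> complex" where
  "fourier u \<xi> = (LINT x|lborel. u x * exp (- \<i> * complex_of_real (\<xi> \<bullet> x)))"

definition inverse_fourier :: "('a::euclidean_space \<Rightarrow> complex) \<Rightarrow> 'a \<Rightarrow> complex" where
  "inverse_fourier u \<xi> =
     complex_of_real (1 / (2 * pi) ^ DIM('a)) *
     (LINT x|lborel. u x * exp (\<i> * complex_of_real (\<xi> \<bullet> x)))"

definition convolve :: "('a::euclidean_space \<Rightarrow> real) \<Rightarrow> ('a \<Rightarrow> real) \<Rightarrow> 'a \<Rightarrow> real" where
  "convolve u v x = (LINT y|lborel. u (x - y) * v y)"

definition locally_integrable ::
    "('a::euclidean_space \<Rightarrow> 'b::{banach, second_countable_topology}) \<Rightarrow> bool" where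
  "locally_integrable u \<longleftrightarrow> (\<forall>K. compact K \<longrightarrow> set_integrable lborel K u)"

definition tempered_measure :: "'a::euclidean_space measure \<Rightarrow> bool" where
  "tempered_measure \<nu> \<longleftrightarrow>
     sets \<nu> = sets borel \<and>
     (\<exists>k::nat. (\<integral>\<^sup>+ x. ennreal (1 / (1 + norm x) ^ k) \<partial>\<nu>) < \<infinity>)"

text \<open>
  \<open>has_bochner_integral\<close> states the identity between the two integrals together with the
  integrability of \<open>g \<phi>\<close>. The integrability of the Fourier transform of \<open>\<phi>\<close> with respect
  to \<open>\<nu>\<close> follows from \<open>tempered_measure \<nu>\<close>.
\<close>

definition has_fourier_transform ::
    "'a::euclidean_space measure \<Rightarrow> ('a \<Rightarrow> complex) \<Rightarrow> bool" where
  "has_fourier_transform \<nu> g \<longleftrightarrow>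
     tempered_measure \<nu> \<and>
     (\<forall>\<phi>::'a \<Rightarrow> complex. schwartz \<phi> \<longrightarrow>
        has_bochner_integral lborel (\<lambda>x. g x * \<phi> x) (LINT \<xi>|\<nu>. fourier \<phi> \<xi>))"

text \<open>
  The conditions on \<open>f\<close> under which the Bochner-Schwartz theorem provides a spectral measure
  (non-negative, non-negative definite, locally integrable, tempered) are not repeated here:
  the relation is meaningful without them, and as a hypothesis it is weaker this way.
\<close>

definition is_spectral_measure ::
    "'a::euclidean_space measure \<Rightarrow> ('a \<Rightarrow> real) \<Rightarrow> bool" where
  "is_spectral_measure \<mu> f \<longleftrightarrow> has_fourier_transform \<mu> (\<lambda>x. complex_of_real (f x))"

end

theory Submission
  imports Defs "HOL-Probability.Characteristic_Functions"
begin

text \<open>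
  Write \<open>q\<close> for the inverse Fourier transform of \<open>\<rho>\<close> and \<open>a = (3 - \<beta>) / 2\<close>. Both
  \<open>norm \<xi> powr (- 2 * a)\<close> and \<open>norm x powr (2 * a - 3)\<close> are mixtures, over \<open>s > 0\<close> with density
  proportional to \<open>s powr (a - 1)\<close>, of \<open>exp (- s * (norm \<xi>)\<^sup>2)\<close> and of its Fourier transform. So for
  \<open>0 < a < 3 / 2\<close> the measure with density \<open>q \<xi> * norm \<xi> powr (- 2 * a)\<close> has the Fourier transform
  \<open>\<rho> * norm powr (2 * a - 3)\<close>, up to a positive constant; it is finite because the integral of
  \<open>exp (- s * (norm \<xi>)\<^sup>2) * q \<xi>\<close> is bounded for small \<open>s\<close>, \<open>\<rho>\<close> being bounded, and decays like
  \<open>s powr (- 3 / 2)\<close> for large \<open>s\<close>, \<open>\<rho>\<close> being integrable. Testing against modulated Gaussians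
  identifies \<open>\<mu>\<close> with a multiple of this measure, and multiplication by
  \<open>norm \<zeta> powr (2 * \<gamma>)\<close> only replaces \<open>a\<close> by \<open>a - \<gamma>\<close>.
\<close>

subsection \<open>Integration on Euclidean space\<close>

text \<open>Tonelli followed by Fubini: finiteness of the iterated integral of the norm gives joint
  integrability, and all three conclusions follow from that. Every interchange of complex-valued
  integrals below uses this form.\<close>

lemma (in pair_sigma_finite) Fubini_nn_bounded:
  fixes f :: "'a \<Rightarrow> 'b \<Rightarrow> 'c::{banach, second_countable_topology}"
  assumes [measurable]: "(\<lambda>(x, y). f x y) \<in> borel_measurable (M1 \<Otimes>\<^sub>M M2)"
    and fin: "(\<integral>\<^sup>+x. \<integral>\<^sup>+y. ennreal (norm (f x y)) \<partial>M2 \<partial>M1) < \<infinity>"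
  shows "(\<integral>y. \<integral>x. f x y \<partial>M1 \<partial>M2) = (\<integral>x. \<integral>y. f x y \<partial>M2 \<partial>M1)"
    and "integrable M1 (\<lambda>x. \<integral>y. f x y \<partial>M2)"
    and "integrable M2 (\<lambda>y. \<integral>x. f x y \<partial>M1)"
proof -
  have int: "integrable (M1 \<Otimes>\<^sub>M M2) (\<lambda>(x, y). f x y)"
  proof (rule integrableI_bounded)
    have "(\<integral>\<^sup>+p. ennreal (norm (case_prod f p)) \<partial>(M1 \<Otimes>\<^sub>M M2)) =
        (\<integral>\<^sup>+x. \<integral>\<^sup>+y. ennreal (norm (f x y)) \<partial>M2 \<partial>M1)"
      by (subst M2.nn_integral_fst[symmetric]) auto
    then show "(\<integral>\<^sup>+p. ennreal (norm (case_prod f p)) \<partial>(M1 \<Otimes>\<^sub>M M2)) < \<infinity>"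
      using fin by simp
  qed measurable
  show "(\<integral>y. \<integral>x. f x y \<partial>M1 \<partial>M2) = (\<integral>x. \<integral>y. f x y \<partial>M2 \<partial>M1)"
    by (rule Fubini_integral[OF int])
  show "integrable M1 (\<lambda>x. \<integral>y. f x y \<partial>M2)"
    using integrable_fst'[OF int] by simp
  show "integrable M2 (\<lambda>y. \<integral>x. f x y \<partial>M1)"
    using integrable_snd[OF int] by simp
qed

lemma integral_lborel_affine:
  fixes f :: "'a::euclidean_space \<Rightarrow> 'b::{banach, second_countable_topology}" and t :: 'a
  assumes [measurable]: "f \<in> borel_measurable borel" and c: "c \<noteq> 0"
  shows "(\<integral>x. f x \<partial>lborel) = (\<bar>c\<bar> ^ DIM('a)) *\<^sub>R (\<integral>x. f (t + c *\<^sub>R x) \<partial>lborel)"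
  by (subst lborel_affine[OF c, of t]) (simp add: integral_density integral_distr)

lemma nn_integral_lborel_affine:
  fixes f :: "'a::euclidean_space \<Rightarrow> ennreal" and t :: 'a
  assumes [measurable]: "f \<in> borel_measurable borel" and c: "c \<noteq> 0"
  shows "(\<integral>\<^sup>+x. f x \<partial>lborel) = ennreal (\<bar>c\<bar> ^ DIM('a)) * (\<integral>\<^sup>+x. f (t + c *\<^sub>R x) \<partial>lborel)"
  by (subst lborel_affine[OF c, of t]) (simp add: nn_integral_density nn_integral_distr nn_integral_cmult)

subsection \<open>Gaussians\<close>

text \<open>A rescaling of the characteristic function of the standard normal distribution.\<close>

lemma gaussian_fourier_real:
  fixes s t :: real
  assumes s: "0 < s"
  shows "has_bochner_integral lborel (\<lambda>x. exp (- s * x\<^sup>2) * iexp (t * x))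
    (sqrt (pi / s) * exp (- t\<^sup>2 / (4 * s)))"
proof -
  \<comment> \<open>The standard deviation for which
    \<open>(x / c)\<^sup>2 / 2 = s * x\<^sup>2\<close>.\<close>
  define c where "c = 1 / sqrt (2 * s)"
  have c: "c > 0" "c\<^sup>2 = 1 / (2 * s)" using s by (auto simp: c_def power_divide)
  have "integrable lborel (\<lambda>x. complex_of_real (std_normal_density x) * iexp ((t * c) * x))"
    by (rule Bochner_Integration.integrable_bound[where f = std_normal_density])
       (auto simp: norm_mult)
  moreover have "(\<integral>x. complex_of_real (std_normal_density x) * iexp ((t * c) * x) \<partial>lborel) =
      char std_normal_distribution (t * c)"
    unfolding char_def by (subst integral_density) (auto simp: scaleR_conv_of_real)
  ultimately have "has_bochner_integral lborel
      (\<lambda>x. complex_of_real (std_normal_density x) * iexp ((t * c) * x)) (exp (- ((t * c)\<^sup>2) / 2))"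
    unfolding char_std_normal_distribution by (auto simp: has_bochner_integral_iff)
  then have "has_bochner_integral lborel
      (\<lambda>x. complex_of_real (std_normal_density (0 + (1 / c) * x)) * iexp ((t * c) * (0 + (1 / c) * x)))
      (complex_of_real (exp (- ((t * c)\<^sup>2) / 2)) /\<^sub>R \<bar>1 / c\<bar>)"
    using c by (intro iffD1[OF lborel_has_bochner_integral_real_affine_iff]) auto
  moreover have "std_normal_density (0 + (1 / c) * x) = (1 / sqrt (2 * pi)) * exp (- s * x\<^sup>2)" for x
    using c s by (simp add: normal_density_def power_divide)
  moreover have "complex_of_real (exp (- ((t * c)\<^sup>2) / 2)) /\<^sub>R \<bar>1 / c\<bar> = c * exp (- ((t * c)\<^sup>2) / 2)"
    using c by (simp add: complex_eq_iff)
  moreover have "t * c * (0 + (1 / c) * x) = t * x" for x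
    using c by simp
  ultimately have "has_bochner_integral lborel
      (\<lambda>x. complex_of_real ((1 / sqrt (2 * pi)) * exp (- s * x\<^sup>2)) * iexp (t * x))
      (c * exp (- ((t * c)\<^sup>2) / 2))"
    by (simp only:)
  from has_bochner_integral_mult_right[OF this, of "complex_of_real (sqrt (2 * pi))"]
  have "has_bochner_integral lborel
      (\<lambda>x. complex_of_real (sqrt (2 * pi)) * (complex_of_real ((1 / sqrt (2 * pi)) * exp (- s * x\<^sup>2)) * iexp (t * x)))
      (complex_of_real (sqrt (2 * pi)) * (c * exp (- ((t * c)\<^sup>2) / 2)))" by simp
  moreover have "complex_of_real (sqrt (2 * pi)) * (complex_of_real ((1 / sqrt (2 * pi)) * exp (- s * x\<^sup>2)) * iexp (t * x))
      = exp (- s * x\<^sup>2) * iexp (t * x)" for x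
    by simp
  moreover have "sqrt (2 * pi) * (c * exp (- ((t * c)\<^sup>2) / 2)) = sqrt (pi / s) * exp (- t\<^sup>2 / (4 * s))"
    using s unfolding power_mult_distrib c(2) by (simp add: c_def real_sqrt_divide real_sqrt_mult)
  ultimately show ?thesis by (simp only: of_real_mult[symmetric])
qed

lemma norm_sq_Basis: "(norm (x::'a::euclidean_space))\<^sup>2 = (\<Sum>b\<in>Basis. (x \<bullet> b)\<^sup>2)"
  by (subst power2_norm_eq_inner, subst euclidean_inner) (simp add: power2_eq_square)

text \<open>Gaussian and character both factor over the coordinates, and \<open>lborel\<close> is
  the image of the product measure under the map \<open>?e\<close> that assembles a point from its
  coordinates. The integral is therefore a product of one-dimensional ones.\<close>

lemma gaussian_fourier:
  fixes x :: "'a::euclidean_space"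
  assumes s: "0 < s"
  shows "has_bochner_integral lborel (\<lambda>\<xi>. complex_of_real (exp (- s * (norm \<xi>)\<^sup>2)) * iexp (x \<bullet> \<xi>))
    (complex_of_real (sqrt (pi / s) ^ DIM('a) * exp (- (norm x)\<^sup>2 / (4 * s))))"
proof -
  interpret product_sigma_finite "\<lambda>_::'a. lborel :: real measure" by standard
  let ?f = "\<lambda>(b::'a) (t::real). complex_of_real (exp (- s * t\<^sup>2)) * iexp ((x \<bullet> b) * t)"
  let ?e = "\<lambda>f. \<Sum>b\<in>(Basis::'a set). f b *\<^sub>R b"
  have eq: "complex_of_real (exp (- s * (norm \<xi>)\<^sup>2)) * iexp (x \<bullet> \<xi>) = (\<Prod>b\<in>Basis. ?f b (\<xi> \<bullet> b))" for \<xi> :: 'a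
  proof -
    have "exp (- s * (norm \<xi>)\<^sup>2) = (\<Prod>b\<in>Basis. exp (- s * (\<xi> \<bullet> b)\<^sup>2))"
      by (simp add: norm_sq_Basis sum_distrib_left exp_sum flip: sum_negf)
    moreover have "iexp (x \<bullet> \<xi>) = (\<Prod>b\<in>Basis. iexp ((x \<bullet> b) * (\<xi> \<bullet> b)))"
      by (subst euclidean_inner) (simp add: sum_distrib_left exp_sum)
    ultimately show ?thesis by (simp add: prod.distrib)
  qed
  have [measurable]: "?e \<in> (\<Pi>\<^sub>M b\<in>Basis. lborel) \<rightarrow>\<^sub>M borel" by measurable
  have F: "has_bochner_integral lborel (?f b) (sqrt (pi / s) * exp (- (x \<bullet> b)\<^sup>2 / (4 * s)))" for b
    using gaussian_fourier_real[OF s, of "x \<bullet> b"] by simp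
  have e: "?e f \<bullet> b = f b" if "b \<in> Basis" for f b
    using that by (simp add: inner_sum_left inner_Basis if_distrib sum.delta cong: if_cong)
  have e': "(\<Prod>b\<in>Basis. ?f b (?e f \<bullet> b)) = (\<Prod>b\<in>Basis. ?f b (f b))" for f
    by (intro prod.cong refl) (simp only: e)
  have Fi: "integrable lborel (?f b)" for b
    using F by (rule integrable.intros)
  have "integrable lborel (\<lambda>\<xi>::'a. \<Prod>b\<in>Basis. ?f b (\<xi> \<bullet> b))"
    by (subst lborel_eq, subst integrable_distr_eq, measurable, simp only: e',
        rule product_integrable_prod, simp, rule Fi)
  moreover have "(\<integral>\<xi>. (\<Prod>b\<in>Basis. ?f b (\<xi> \<bullet> b)) \<partial>(lborel :: 'a measure)) =
      (\<Prod>b\<in>Basis. integral\<^sup>L lborel (?f b))"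
    by (subst lborel_eq, subst integral_distr, measurable, simp only: e',
        rule product_integral_prod, simp, rule Fi)
  moreover have "(\<Prod>b\<in>Basis. integral\<^sup>L lborel (?f b)) =
      (\<Prod>b\<in>(Basis::'a set). complex_of_real (sqrt (pi / s) * exp (- (x \<bullet> b)\<^sup>2 / (4 * s))))"
    using F by (auto simp: has_bochner_integral_iff)
  moreover have "(\<Prod>b\<in>(Basis::'a set). sqrt (pi / s) * exp (- (x \<bullet> b)\<^sup>2 / (4 * s)))
     = sqrt (pi / s) ^ DIM('a) * exp (- (norm x)\<^sup>2 / (4 * s))"
    by (simp add: prod.distrib norm_sq_Basis sum_divide_distrib exp_sum flip: sum_negf)
  ultimately show ?thesis
    unfolding eq has_bochner_integral_iff by (simp only: of_real_prod[symmetric])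
qed

lemma gaussian_integral:
  fixes c :: "'a::euclidean_space"
  assumes s: "0 < s"
  shows "(\<integral>\<^sup>+\<xi>. ennreal (exp (- s * (norm (\<xi> - c))\<^sup>2)) \<partial>lborel) = ennreal (sqrt (pi / s) ^ DIM('a))"
proof -
  have "has_bochner_integral lborel (\<lambda>\<xi>::'a. complex_of_real (exp (- s * (norm \<xi>)\<^sup>2)))
      (complex_of_real (sqrt (pi / s) ^ DIM('a)))"
    using gaussian_fourier[OF s, of "0::'a"] by simp
  then have "has_bochner_integral lborel (\<lambda>\<xi>::'a. exp (- s * (norm \<xi>)\<^sup>2)) (sqrt (pi / s) ^ DIM('a))"
    by (auto dest: has_bochner_integral_Re simp del: of_real_power of_real_exp)
  then have "(\<integral>\<^sup>+\<xi>. ennreal (exp (- s * (norm \<xi>)\<^sup>2)) \<partial>(lborel::'a measure)) = ennreal (sqrt (pi / s) ^ DIM('a))"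
    by (subst nn_integral_eq_integral) (auto simp: has_bochner_integral_iff)
  then show ?thesis
    by (subst nn_integral_lborel_affine[where c = 1 and t = c]) auto
qed

subsection \<open>Mixtures of exponentials\<close>

text \<open>Euler's integral for \<open>Gamma a\<close> after the substitution
  \<open>t = r * s\<close>. It is stated for non-negative integrals so that it can be combined with
  Tonelli directly.\<close>

lemma gamma_mixture:
  assumes a: "0 < a" and r: "0 < (r::real)"
  shows "(\<integral>\<^sup>+s. ennreal (indicator {0<..} s * s powr (a - 1) * exp (- s * r)) \<partial>lborel) =
    ennreal (Gamma a * r powr - a)"
proof -
  let ?I = "\<integral>\<^sup>+s. ennreal (indicator {0<..} s * s powr (a - 1) * exp (- s * r)) \<partial>lborel"
  have "ennreal (Gamma a) = (\<integral>\<^sup>+t. ennreal (indicator {0..} t * t powr (a - 1) / exp t) \<partial>lborel)"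
    by (rule Gamma_conv_nn_integral_real[OF a])
  also have "\<dots> = ennreal r * (\<integral>\<^sup>+s. ennreal (indicator {0..} (r * s) * (r * s) powr (a - 1) / exp (r * s)) \<partial>lborel)"
    using r by (subst nn_integral_real_affine[where c = r and t = 0]) auto
  also have "(\<integral>\<^sup>+s. ennreal (indicator {0..} (r * s) * (r * s) powr (a - 1) / exp (r * s)) \<partial>lborel) =
      (\<integral>\<^sup>+s. ennreal (r powr (a - 1)) * ennreal (indicator {0<..} s * s powr (a - 1) * exp (- s * r)) \<partial>lborel)"
  proof (rule nn_integral_cong)
    fix s :: real
    show "ennreal (indicator {0..} (r * s) * (r * s) powr (a - 1) / exp (r * s)) =
      ennreal (r powr (a - 1)) * ennreal (indicator {0<..} s * s powr (a - 1) * exp (- s * r))"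
      \<comment> \<open>The two indicators differ only at \<open>s = 0\<close>, where
        \<open>0 powr (a - 1)\<close> is 0 by convention.\<close>
      using r by (cases "s = 0"; cases "s > 0")
        (auto simp: indicator_def powr_mult exp_minus field_simps zero_le_mult_iff ennreal_mult[symmetric])
  qed
  also have "\<dots> = ennreal (r powr (a - 1)) * ?I"
    by (subst nn_integral_cmult) auto
  finally have "ennreal (r powr a) * ?I = ennreal (Gamma a)"
    using r by (simp add: mult.assoc[symmetric] ennreal_mult[symmetric] powr_diff)
  then have "ennreal (r powr - a) * (ennreal (r powr a) * ?I) = ennreal (Gamma a * r powr - a)"
    using Gamma_real_pos[OF a] by (simp add: ennreal_mult[symmetric] mult.commute)
  then show ?thesis using r
    by (simp add: mult.assoc[symmetric] ennreal_mult[symmetric] powr_minus)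
qed

lemma nn_integral_powr_from_0:
  assumes "0 < (a::real)"
  shows "(\<integral>\<^sup>+s. ennreal (indicator {0<..1} s * s powr (a - 1)) \<partial>lborel) < \<infinity>"
proof -
  have "(\<integral>\<^sup>+s. ennreal (indicator {0..1} s * s powr (a - 1)) \<partial>lborel) < \<infinity>"
    using nn_integral_has_integral_lebesgue[OF _ has_integral_powr_from_0[of "a - 1" 1]] assms by simp
  then show ?thesis
    by (rule order.strict_trans1[OF nn_integral_mono, rotated]) (auto simp: indicator_def)
qed

lemma nn_integral_powr_to_inf:
  assumes "e < (-1::real)"
  shows "(\<integral>\<^sup>+s. ennreal (indicator {1<..} s * s powr e) \<partial>lborel) < \<infinity>"
proof -
  have "(\<integral>\<^sup>+s. ennreal (indicator {1..} s * s powr e) \<partial>lborel) < \<infinity>"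
    using nn_integral_has_integral_lebesgue[OF _ has_integral_powr_to_inf[of e 1]] assms by simp
  then show ?thesis
    by (rule order.strict_trans1[OF nn_integral_mono, rotated]) (auto simp: indicator_def)
qed

text \<open>One term of the exponential series is at most the whole sum.\<close>

lemma power_le_fact_exp:
  assumes "0 \<le> (x::real)"
  shows "x ^ k \<le> fact k * exp x"
proof -
  have "x ^ k /\<^sub>R fact k \<le> (\<Sum>i\<le>k. x ^ i /\<^sub>R fact i)"
    using assms by (intro member_le_sum) auto
  also have "\<dots> \<le> exp x"
    unfolding exp_def using assms by (intro sum_le_suminf summable_exp_generic) auto
  finally show ?thesis by (simp add: field_simps)
qed

text \<open>The substitution of \<open>r * s\<close> for \<open>s\<close> pulls out the factor
  \<open>r powr - b\<close>, so \<open>K\<close> is the value of the integral at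
  \<open>r = 1\<close>. What remains is that this value is finite and positive.\<close>

lemma inverse_gamma_mixture:
  assumes b: "0 < (b::real)"
  obtains K where "0 < K" and "\<And>r. 0 < r \<Longrightarrow>
    (\<integral>\<^sup>+s. ennreal (indicator {0<..} s * s powr (- b - 1) * exp (- r / s)) \<partial>lborel) = ennreal (K * r powr - b)"
proof -
  let ?g = "\<lambda>r s::real. indicator {0<..} s * s powr (- b - 1) * exp (- r / s)"
  define I where "I = (\<integral>\<^sup>+s. ennreal (?g 1 s) \<partial>lborel)"
  \<comment> \<open>For \<open>s \<le> 1\<close> the singular factor is at most
    \<open>(1 / s) ^ N\<close>, and the decay of \<open>exp (- 1 / s)\<close> absorbs an integer
    power by \<open>power_le_fact_exp\<close>. For \<open>s > 1\<close> the exponential is simply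
    bounded by 1.\<close>
  obtain N :: nat where N: "b + 1 \<le> real N" using real_arch_simple by blast
  have le: "?g 1 s \<le> fact N * indicator {0..1} s + indicator {1<..} s * s powr (- b - 1)" for s
  proof (cases "0 < s \<and> s \<le> 1")
    case True
    have "(1 / s) powr (b + 1) \<le> (1 / s) powr (real N)" using True N by (intro powr_mono) auto
    also have "\<dots> = (1 / s) ^ N" using True by (simp add: powr_realpow)
    also have "\<dots> \<le> fact N * exp (1 / s)" using True by (intro power_le_fact_exp) simp
    finally have "(1 / s) powr (b + 1) \<le> fact N * exp (1 / s)" by simp
    then have "s powr (- b - 1) * exp (- 1 / s) \<le> fact N"
      using True by (simp add: powr_divide powr_minus_divide exp_minus field_simps powr_diff powr_add)
    then show ?thesis using True by (simp add: indicator_def)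
  next
    case False
    then show ?thesis by (auto simp: indicator_def mult_left_le)
  qed
  have "I \<le> (\<integral>\<^sup>+s. ennreal (fact N * indicator {0..1} s + indicator {1<..} s * s powr (- b - 1)) \<partial>lborel)"
    unfolding I_def by (intro nn_integral_mono ennreal_leI le)
  also have "\<dots> = (\<integral>\<^sup>+s. ennreal (fact N * indicator {0..1::real} s) \<partial>lborel) +
      (\<integral>\<^sup>+s. ennreal (indicator {1<..} s * s powr (- b - 1)) \<partial>lborel)"
    by (subst nn_integral_add[symmetric]) (auto simp: ennreal_plus)
  also have "\<dots> < \<infinity>"
    using nn_integral_powr_to_inf[of "- b - 1"] b
    by (auto simp: ennreal_mult nn_integral_cmult ennreal_indicator[symmetric] ennreal_mult_less_top simp del: ennreal_indicator)
       (simp add: ennreal_indicator)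
  finally have fin: "I < \<infinity>" .
  \<comment> \<open>Positivity: on the interval from 1 to 2 the integrand is at least this
    constant.\<close>
  have "(0::ennreal) < ennreal (2 powr (- b - 1) * exp (- 1)) * emeasure lborel {1..2::real}"
    by (simp add: ennreal_zero_less_mult_iff)
  also have "\<dots> = (\<integral>\<^sup>+s. ennreal (2 powr (- b - 1) * exp (- 1)) * indicator {1..2::real} s \<partial>lborel)"
    by (subst nn_integral_cmult_indicator) auto
  also have "\<dots> \<le> I"
    unfolding I_def
  proof (intro nn_integral_mono)
    fix s :: real
    show "ennreal (2 powr (- b - 1) * exp (- 1)) * indicator {1..2::real} s \<le> ennreal (?g 1 s)"
      using b by (auto simp: indicator_def field_simps intro!: ennreal_leI mult_mono powr_mono2')
  qed
  finally have pos: "I > 0" .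
  define K where "K = enn2real I"
  have K: "ennreal K = I" "K > 0" using fin pos by (auto simp: K_def enn2real_positive_iff less_top)
  have "(\<integral>\<^sup>+s. ennreal (?g r s) \<partial>lborel) = ennreal (K * r powr - b)" if r: "0 < r" for r
  proof -
    have "(\<integral>\<^sup>+s. ennreal (?g r s) \<partial>lborel) = ennreal r * (\<integral>\<^sup>+s. ennreal (?g r (0 + r * s)) \<partial>lborel)"
      using r by (subst nn_integral_real_affine[where c = r and t = 0]) auto
    also have "(\<integral>\<^sup>+s. ennreal (?g r (0 + r * s)) \<partial>lborel) = (\<integral>\<^sup>+s. ennreal (r powr (- b - 1)) * ennreal (?g 1 s) \<partial>lborel)"
      using r by (intro nn_integral_cong)
        (auto simp: indicator_def powr_mult zero_less_mult_iff ennreal_mult[symmetric])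
    also have "\<dots> = ennreal (r powr (- b - 1)) * I"
      unfolding I_def by (subst nn_integral_cmult) auto
    finally show ?thesis
      using r K(2) by (simp add: K(1)[symmetric] ennreal_mult[symmetric] powr_diff mult.commute)
  qed
  then show ?thesis using K that by blast
qed

subsection \<open>Riesz potentials of a density with non-negative inverse Fourier transform\<close>

text \<open>Collects the properties of \<open>\<rho>\<close> on which the Riesz potentials rest. The
  inverse Fourier transform is represented by a real function \<open>q\<close>, so that it can serve
  as the density of a measure.\<close>

locale pos_def_density =
  fixes \<rho> q :: "'a::euclidean_space \<Rightarrow> real" and M :: real
  assumes integrable: "integrable lborel \<rho>"
    and nonneg: "\<And>x. 0 \<le> \<rho> x" and bounded: "\<And>x. \<rho> x \<le> M"
    and inverse: "\<And>\<xi>. inverse_fourier (\<lambda>x. complex_of_real (\<rho> x)) \<xi> = complex_of_real (q \<xi>)"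
    and q_nonneg: "\<And>\<xi>. 0 \<le> q \<xi>"
begin


lemma measurable_rho[measurable]: "\<rho> \<in> borel_measurable borel"
  using integrable by auto

lemma measurable_q[measurable]: "q \<in> borel_measurable borel"
proof -
  have "q = (\<lambda>\<xi>. Re (inverse_fourier (\<lambda>x. complex_of_real (\<rho> x)) \<xi>))"
    using inverse by simp
  also have "\<dots> \<in> borel_measurable borel"
    unfolding inverse_fourier_def by measurable
  finally show ?thesis .
qed

text \<open>The convolution of \<open>\<rho>\<close> with the heat kernel at time \<open>s\<close>,
  without its normalising factor.\<close>

definition gauss_smooth :: "real \<Rightarrow> 'a \<Rightarrow> real" where
  "gauss_smooth s x = (\<integral>y. \<rho> y * exp (- (norm (x - y))\<^sup>2 / (4 * s)) \<partial>lborel)"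

lemma gauss_smooth_measurable[measurable]: "(\<lambda>s. gauss_smooth s x) \<in> borel_measurable borel"
  unfolding gauss_smooth_def by measurable

lemma gauss_smooth_nonneg: "0 \<le> gauss_smooth s x"
  unfolding gauss_smooth_def using nonneg by (intro integral_nonneg_AE) auto

lemma nn_gauss_smooth:
  assumes "0 < s"
  shows "ennreal (gauss_smooth s x) = (\<integral>\<^sup>+y. ennreal (\<rho> y * exp (- (norm (x - y))\<^sup>2 / (4 * s))) \<partial>lborel)"
proof -
  have "integrable lborel (\<lambda>y. \<rho> y * exp (- (norm (x - y))\<^sup>2 / (4 * s)))"
    using assms nonneg by (intro Bochner_Integration.integrable_bound[OF integrable]) (auto simp: mult_left_le)
  then show ?thesis
    unfolding gauss_smooth_def using nonneg by (subst nn_integral_eq_integral) auto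
qed

text \<open>The bound used for large \<open>s\<close>: the exponential is at most 1.\<close>

lemma gauss_smooth_le_integral:
  assumes "0 < s"
  shows "gauss_smooth s x \<le> integral\<^sup>L lborel \<rho>"
  unfolding gauss_smooth_def using assms nonneg
  by (intro integral_mono_AE' integrable) (auto simp: mult_left_le)

text \<open>The bound used for small \<open>s\<close>: estimating \<open>\<rho>\<close> by
  \<open>M\<close> leaves a Gaussian integral.\<close>

lemma gauss_smooth_le_sup:
  assumes s: "0 < s"
  shows "gauss_smooth s x \<le> M * sqrt (4 * pi * s) ^ DIM('a)"
proof -
  have M: "0 \<le> M" using nonneg bounded by (rule order_trans)
  have "ennreal (gauss_smooth s x) \<le> (\<integral>\<^sup>+y. ennreal M * ennreal (exp (- (1 / (4 * s)) * (norm (y - x))\<^sup>2)) \<partial>lborel)"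
    unfolding nn_gauss_smooth[OF s] using nonneg bounded M
    by (intro nn_integral_mono) (auto simp: ennreal_mult[symmetric] norm_minus_commute intro!: ennreal_leI mult_right_mono)
  also have "\<dots> = ennreal M * ennreal (sqrt (pi / (1 / (4 * s))) ^ DIM('a))"
    using s by (subst nn_integral_cmult, measurable, subst gaussian_integral) auto
  also have "\<dots> = ennreal (M * sqrt (4 * pi * s) ^ DIM('a))"
    using s M by (simp add: ennreal_mult[symmetric] mult.commute mult.left_commute)
  finally show ?thesis
    using M s by (subst (asm) ennreal_le_iff) auto
qed

text \<open>The normalisation of \<open>inverse_fourier\<close> times the integral of
  \<open>exp (- s * (norm \<xi>)\<^sup>2)\<close>.\<close>

definition gauss_const :: "real \<Rightarrow> real" where
  "gauss_const s = (1 / (2 * pi) ^ DIM('a)) * sqrt (pi / s) ^ DIM('a)"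

text \<open>Insert the integral that defines \<open>q\<close> and integrate over
  \<open>\<xi>\<close> first: this gives the Fourier transform of a Gaussian at
  \<open>y - x\<close>. The factor \<open>exp (- s * (norm \<xi>)\<^sup>2)\<close> makes the double
  integral converge absolutely.\<close>

lemma gaussian_transform:
  assumes s: "0 < s"
  shows "has_bochner_integral lborel
    (\<lambda>\<xi>. complex_of_real (exp (- s * (norm \<xi>)\<^sup>2) * q \<xi>) * iexp (- (x \<bullet> \<xi>)))
    (complex_of_real (gauss_const s * gauss_smooth s x))"
proof -
  \<comment> \<open>The integrand with \<open>q\<close> replaced by its defining integral; the
    missing factor \<open>(2 * pi) ^ DIM('a)\<close> reappears in \<open>inner2\<close>.\<close>
  let ?f = "\<lambda>y \<xi>. complex_of_real (\<rho> y * exp (- s * (norm \<xi>)\<^sup>2)) * iexp ((y - x) \<bullet> \<xi>)"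
  have "(\<integral>\<^sup>+y. \<integral>\<^sup>+\<xi>. ennreal (norm (?f y \<xi>)) \<partial>lborel \<partial>lborel) =
      (\<integral>\<^sup>+y. ennreal (\<rho> y) * (\<integral>\<^sup>+\<xi>. ennreal (exp (- s * (norm (\<xi> - 0))\<^sup>2)) \<partial>(lborel :: 'a measure)) \<partial>lborel)"
    using nonneg by (subst nn_integral_cmult[symmetric]) (auto simp: norm_mult ennreal_mult)
  also have "\<dots> = (\<integral>\<^sup>+y. ennreal (\<rho> y) \<partial>lborel) * ennreal (sqrt (pi / s) ^ DIM('a))"
    unfolding gaussian_integral[OF s] by (subst nn_integral_multc) auto
  also have "\<dots> < \<infinity>"
    using integrable nonneg s by (subst nn_integral_eq_integral) (auto simp: ennreal_mult_less_top)
  finally have fin: "(\<integral>\<^sup>+y. \<integral>\<^sup>+\<xi>. ennreal (norm (?f y \<xi>)) \<partial>lborel \<partial>lborel) < \<infinity>" .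
  have meas: "(\<lambda>(y, \<xi>). ?f y \<xi>) \<in> borel_measurable (lborel \<Otimes>\<^sub>M lborel)"
    by measurable
  note F = lborel_pair.Fubini_nn_bounded[OF meas fin]
  have inner1: "(\<integral>\<xi>. ?f y \<xi> \<partial>lborel) =
      complex_of_real (\<rho> y) * (sqrt (pi / s) ^ DIM('a) * exp (- (norm (x - y))\<^sup>2 / (4 * s)))" for y
    using has_bochner_integral_mult_right[OF gaussian_fourier[OF s, of "y - x"], of "complex_of_real (\<rho> y)"]
    by (auto simp: has_bochner_integral_iff mult.assoc norm_minus_commute)
  have inner2: "(\<integral>y. ?f y \<xi> \<partial>lborel) =
      complex_of_real ((2 * pi) ^ DIM('a)) * (complex_of_real (exp (- s * (norm \<xi>)\<^sup>2) * q \<xi>) * iexp (- (x \<bullet> \<xi>)))" for \<xi>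
  proof -
    have "?f y \<xi> = (complex_of_real (exp (- s * (norm \<xi>)\<^sup>2)) * iexp (- (x \<bullet> \<xi>))) *
        (complex_of_real (\<rho> y) * exp (\<i> * complex_of_real (\<xi> \<bullet> y)))" for y
      by (simp add: inner_diff_left inner_commute algebra_simps flip: exp_add)
    moreover have "(\<integral>y. complex_of_real (\<rho> y) * exp (\<i> * complex_of_real (\<xi> \<bullet> y)) \<partial>lborel) =
        complex_of_real ((2 * pi) ^ DIM('a)) * q \<xi>"
      using inverse[of \<xi>] by (auto simp: inverse_fourier_def field_simps)
    ultimately show ?thesis by (simp only: integral_mult_right_zero) simp
  qed
  have "integrable lborel (\<lambda>\<xi>. complex_of_real ((2 * pi) ^ DIM('a)) *
      (complex_of_real (exp (- s * (norm \<xi>)\<^sup>2) * q \<xi>) * iexp (- (x \<bullet> \<xi>))))"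
    using F(3) unfolding inner2 .
  then have "integrable lborel (\<lambda>\<xi>. inverse (complex_of_real ((2 * pi) ^ DIM('a))) * (complex_of_real ((2 * pi) ^ DIM('a)) *
      (complex_of_real (exp (- s * (norm \<xi>)\<^sup>2) * q \<xi>) * iexp (- (x \<bullet> \<xi>)))))"
    by (rule integrable_mult_right)
  then have "integrable lborel (\<lambda>\<xi>. complex_of_real (exp (- s * (norm \<xi>)\<^sup>2) * q \<xi>) * iexp (- (x \<bullet> \<xi>)))"
    by (rule back_subst[of "integrable lborel"])
       (simp add: mult.assoc[symmetric] del: of_real_power of_real_mult)
  moreover have "complex_of_real ((2 * pi) ^ DIM('a)) *
      (\<integral>\<xi>. complex_of_real (exp (- s * (norm \<xi>)\<^sup>2) * q \<xi>) * iexp (- (x \<bullet> \<xi>)) \<partial>lborel) =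
      (\<integral>y. complex_of_real (sqrt (pi / s) ^ DIM('a) * (\<rho> y * exp (- (norm (x - y))\<^sup>2 / (4 * s)))) \<partial>lborel)"
    using F(1) unfolding inner1 inner2 integral_mult_right_zero by (simp add: mult_ac)
  moreover have "\<dots> = complex_of_real (sqrt (pi / s) ^ DIM('a) * gauss_smooth s x)"
    unfolding gauss_smooth_def by (simp only: integral_complex_of_real integral_mult_right_zero)
  ultimately show ?thesis
    by (auto simp: has_bochner_integral_iff gauss_const_def field_simps)
qed

lemma nn_gaussian_transform:
  assumes s: "0 < s"
  shows "(\<integral>\<^sup>+\<xi>. ennreal (exp (- s * (norm \<xi>)\<^sup>2) * q \<xi>) \<partial>lborel) = ennreal (gauss_const s * gauss_smooth s 0)"
proof -
  have "has_bochner_integral lborel (\<lambda>\<xi>. complex_of_real (exp (- s * (norm \<xi>)\<^sup>2) * q \<xi>))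
      (complex_of_real (gauss_const s * gauss_smooth s 0))"
    using gaussian_transform[OF s, of 0] by simp
  from has_bochner_integral_Re[OF this]
  show ?thesis
    using q_nonneg by (subst nn_integral_eq_integral) (auto simp: has_bochner_integral_iff)
qed

lemma gauss_const_pos: "0 < s \<Longrightarrow> 0 < gauss_const s"
  by (auto simp: gauss_const_def)

lemma gauss_const_powr: "0 < s \<Longrightarrow> gauss_const s = gauss_const 1 * s powr (- real DIM('a) / 2)"
  by (simp add: gauss_const_def real_sqrt_divide power_divide powr_minus_divide powr_powr[symmetric] powr_half_sqrt[symmetric] powr_realpow[symmetric])
     (simp add: powr_powr)

text \<open>The powers of \<open>s\<close> in \<open>gauss_const\<close> and in
  \<open>gauss_smooth_le_sup\<close> cancel: a normalised Gaussian average of \<open>\<rho>\<close>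
  is at most its upper bound, uniformly in \<open>s\<close>.\<close>

lemma nn_gaussian_transform_le_sup:
  assumes s: "0 < s"
  shows "gauss_const s * gauss_smooth s 0 \<le> M"
proof -
  have "gauss_const s * gauss_smooth s 0 \<le> gauss_const s * (M * sqrt (4 * pi * s) ^ DIM('a))"
    using gauss_smooth_le_sup[OF s] gauss_const_pos[OF s] by (intro mult_left_mono) auto
  also have "\<dots> = M * ((1 / (2 * pi)) * (sqrt (pi / s) * sqrt (4 * pi * s))) ^ DIM('a)"
    by (simp add: gauss_const_def power_mult_distrib power_divide mult_ac)
  also have "sqrt (pi / s) * sqrt (4 * pi * s) = sqrt ((pi / s) * (4 * pi * s))"
    by (simp only: real_sqrt_mult)
  also have "(pi / s) * (4 * pi * s) = (2 * pi)\<^sup>2"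
    using s by (simp add: power2_eq_square)
  also have "sqrt ((2 * pi)\<^sup>2) = 2 * pi"
    by (intro real_sqrt_unique) auto
  finally show ?thesis by simp
qed

text \<open>Writing the power of the norm as a mixture of Gaussians and integrating over
  \<open>\<xi>\<close> first leaves an integral over \<open>s\<close>. It converges at 0 because
  \<open>0 < a\<close> and at infinity because \<open>2 * a < real DIM('a)\<close>. The second claim
  is the absolute convergence on which the interchange in \<open>riesz_fourier\<close>
  rests.\<close>

lemma riesz_finite:
  assumes a: "0 < a" and an: "2 * a < real DIM('a)"
  shows "(\<integral>\<^sup>+\<xi>. ennreal (q \<xi> * norm \<xi> powr (- 2 * a)) \<partial>lborel) < \<infinity>"
    and "(\<integral>\<^sup>+\<xi>. \<integral>\<^sup>+s. ennreal (indicator {0<..} s * s powr (a - 1) * (exp (- s * (norm \<xi>)\<^sup>2) * q \<xi>)) \<partial>lborel \<partial>lborel) < \<infinity>"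
proof -
  let ?w = "\<lambda>s::real. indicator {0<..} s * s powr (a - 1)"
  let ?J = "\<integral>\<^sup>+\<xi>. \<integral>\<^sup>+s. ennreal (?w s * (exp (- s * (norm \<xi>)\<^sup>2) * q \<xi>)) \<partial>lborel \<partial>lborel"
  define R where "R = integral\<^sup>L lborel \<rho>"
  have M: "0 \<le> M" using nonneg bounded by (rule order_trans)
  have R: "0 \<le> R" unfolding R_def using nonneg by (intro integral_nonneg_AE) auto
  have "?J = (\<integral>\<^sup>+s. \<integral>\<^sup>+\<xi>. ennreal (?w s * (exp (- s * (norm \<xi>)\<^sup>2) * q \<xi>)) \<partial>lborel \<partial>lborel)"
    by (rule lborel_pair.Fubini') measurable
  also have "\<dots> = (\<integral>\<^sup>+s. ennreal (?w s) * ennreal (gauss_const s * gauss_smooth s 0) \<partial>lborel)"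
  proof (rule nn_integral_cong)
    fix s :: real
    have "(\<integral>\<^sup>+\<xi>. ennreal (?w s * (exp (- s * (norm \<xi>)\<^sup>2) * q \<xi>)) \<partial>lborel) =
        ennreal (?w s) * (\<integral>\<^sup>+\<xi>. ennreal (exp (- s * (norm \<xi>)\<^sup>2) * q \<xi>) \<partial>lborel)"
      using q_nonneg by (subst nn_integral_cmult[symmetric]) (auto simp: ennreal_mult)
    then show "(\<integral>\<^sup>+\<xi>. ennreal (?w s * (exp (- s * (norm \<xi>)\<^sup>2) * q \<xi>)) \<partial>lborel) =
        ennreal (?w s) * ennreal (gauss_const s * gauss_smooth s 0)"
      using nn_gaussian_transform[of s] by (cases "0 < s") simp_all
  qed
  \<comment> \<open>Split at \<open>s = 1\<close>: the uniform bound \<open>M\<close> below, the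
    decay \<open>s powr (- real DIM('a) / 2)\<close> of \<open>gauss_const\<close> above.\<close>
  also have "\<dots> \<le> (\<integral>\<^sup>+s. ennreal M * ennreal (indicator {0<..1} s * s powr (a - 1)) +
      ennreal (gauss_const 1 * R) * ennreal (indicator {1<..} s * s powr (a - 1 - real DIM('a) / 2)) \<partial>lborel)"
  proof (rule nn_integral_mono)
    fix s :: real
    consider "s \<le> 0" | "0 < s" "s \<le> 1" | "1 < s" by linarith
    then show "ennreal (?w s) * ennreal (gauss_const s * gauss_smooth s 0) \<le>
        ennreal M * ennreal (indicator {0<..1} s * s powr (a - 1)) +
        ennreal (gauss_const 1 * R) * ennreal (indicator {1<..} s * s powr (a - 1 - real DIM('a) / 2))"
    proof cases
      case 2
      then show ?thesis
        using nn_gaussian_transform_le_sup[of s] M gauss_smooth_nonneg[of s 0]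
        by (auto simp: mult.commute[of "ennreal M"] intro!: mult_left_mono ennreal_leI)
    next
      case 3
      have "s powr (a - 1) * (gauss_const s * gauss_smooth s 0) \<le>
          s powr (a - 1) * (gauss_const s * R)"
        using 3 gauss_smooth_le_integral[of s 0] gauss_const_pos[of s]
        by (intro mult_left_mono) (auto simp: R_def)
      also have "\<dots> = gauss_const 1 * R * s powr (a - 1 - real DIM('a) / 2)"
      proof -
        have "s powr (a - 1) * s powr (- real DIM('a) / 2) = s powr (a - 1 - real DIM('a) / 2)"
          by (simp add: powr_add[symmetric])
        then show ?thesis
          using 3 by (subst gauss_const_powr) (auto simp: mult_ac)
      qed
      finally show ?thesis
        using 3 gauss_const_pos[of s] gauss_const_pos[of 1] R gauss_smooth_nonneg[of s 0]
        by (auto simp: ennreal_mult[symmetric] intro!: ennreal_leI)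
    qed auto
  qed
  also have "\<dots> = ennreal M * (\<integral>\<^sup>+s. ennreal (indicator {0<..1} s * s powr (a - 1)) \<partial>lborel) +
      ennreal (gauss_const 1 * R) * (\<integral>\<^sup>+s. ennreal (indicator {1<..} s * s powr (a - 1 - real DIM('a) / 2)) \<partial>lborel)"
    by (subst nn_integral_add; (subst nn_integral_cmult)?) (auto simp: nn_integral_cmult)
  also have "\<dots> < \<infinity>"
    using nn_integral_powr_from_0[OF a] nn_integral_powr_to_inf[of "a - 1 - real DIM('a) / 2"] an
    by (simp add: ennreal_mult_less_top)
  finally show J: "?J < \<infinity>" .
  have "?J = (\<integral>\<^sup>+\<xi>. ennreal (Gamma a) * ennreal (q \<xi> * norm \<xi> powr (- 2 * a)) \<partial>lborel)"
  \<comment> \<open>The origin is a null set and must be left out: there the integral over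
    \<open>s\<close> diverges if \<open>q\<close> is positive, while \<open>0 powr (- 2 * a)\<close>
    is 0.\<close>
  proof (rule nn_integral_cong_AE, rule AE_mp[OF AE_lborel_singleton[of 0]], rule AE_I2, rule impI)
    fix \<xi> :: 'a assume "\<xi> \<noteq> 0"
    have "(\<integral>\<^sup>+s. ennreal (?w s * (exp (- s * (norm \<xi>)\<^sup>2) * q \<xi>)) \<partial>lborel) =
        ennreal (q \<xi>) * (\<integral>\<^sup>+s. ennreal (?w s * exp (- s * (norm \<xi>)\<^sup>2)) \<partial>lborel)"
      using q_nonneg by (subst nn_integral_cmult[symmetric]) (auto simp: ennreal_mult[symmetric] mult_ac)
    also have "\<dots> = ennreal (q \<xi>) * ennreal (Gamma a * ((norm \<xi>)\<^sup>2) powr - a)"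
      using \<open>\<xi> \<noteq> 0\<close> by (subst gamma_mixture[OF a]) auto
    also have "((norm \<xi>)\<^sup>2) powr - a = norm \<xi> powr (- 2 * a)"
      using \<open>\<xi> \<noteq> 0\<close> by (simp add: powr_powr flip: powr_numeral)
    finally show "(\<integral>\<^sup>+s. ennreal (?w s * (exp (- s * (norm \<xi>)\<^sup>2) * q \<xi>)) \<partial>lborel) =
        ennreal (Gamma a) * ennreal (q \<xi> * norm \<xi> powr (- 2 * a))"
      using q_nonneg Gamma_real_pos[OF a] by (simp add: ennreal_mult[symmetric] mult_ac)
  qed
  also have "\<dots> = ennreal (Gamma a) * (\<integral>\<^sup>+\<xi>. ennreal (q \<xi> * norm \<xi> powr (- 2 * a)) \<partial>lborel)"
    by (subst nn_integral_cmult) auto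
  finally show "(\<integral>\<^sup>+\<xi>. ennreal (q \<xi> * norm \<xi> powr (- 2 * a)) \<partial>lborel) < \<infinity>"
    using J Gamma_real_pos[OF a] by (auto simp: ennreal_mult_less_top)
qed

text \<open>The double integral of \<open>riesz_finite\<close>, now with the character inserted, is
  evaluated in both orders. Integrating over \<open>s\<close> first gives the transform sought.
  Integrating over \<open>\<xi>\<close> first gives \<open>gauss_smooth\<close>, whose integral over
  \<open>s\<close> is an inverse Gamma mixture that produces the Riesz kernel.\<close>

lemma riesz_fourier:
  assumes a: "0 < a" and an: "2 * a < real DIM('a)"
  obtains C where "0 < C" and "\<And>x. (\<integral>\<xi>. complex_of_real (q \<xi> * norm \<xi> powr (- 2 * a)) * iexp (- (x \<bullet> \<xi>)) \<partial>lborel)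
    = complex_of_real (C * convolve \<rho> (\<lambda>y. 1 / norm y powr (real DIM('a) - 2 * a)) x)"
proof -
  \<comment> \<open>Chosen so that \<open>s powr (a - 1)\<close> times the factor
    \<open>s powr (- real DIM('a) / 2)\<close> of \<open>gauss_const\<close> is
    \<open>s powr (- b - 1)\<close>.\<close>
  define b where "b = real DIM('a) / 2 - a"
  have b: "0 < b" using an by (simp add: b_def)
  from inverse_gamma_mixture[OF b] obtain K where K: "0 < K" and mix: "\<And>r. 0 < r \<Longrightarrow>
    (\<integral>\<^sup>+s. ennreal (indicator {0<..} s * s powr (- b - 1) * exp (- r / s)) \<partial>lborel) = ennreal (K * r powr - b)"
    by blast
  let ?w = "\<lambda>s::real. indicator {0<..} s * s powr (a - 1)"
  \<comment> \<open>\<open>Gamma a\<close> and \<open>K\<close> come from the two mixtures, and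
    \<open>4 powr b\<close> from the 4 in the exponent of the heat kernel.\<close>
  define C where "C = gauss_const 1 * K * 4 powr b / Gamma a"
  have G: "0 < Gamma a" using a by (rule Gamma_real_pos)
  have C: "0 < C" using K gauss_const_pos[of 1] G by (auto simp: C_def)
  have "(\<integral>\<xi>. complex_of_real (q \<xi> * norm \<xi> powr (- 2 * a)) * iexp (- (x \<bullet> \<xi>)) \<partial>lborel)
    = complex_of_real (C * convolve \<rho> (\<lambda>y. 1 / norm y powr (real DIM('a) - 2 * a)) x)" for x
  proof -
    let ?f = "\<lambda>\<xi> s. complex_of_real (?w s * (exp (- s * (norm \<xi>)\<^sup>2) * q \<xi>)) * iexp (- (x \<bullet> \<xi>))"
    have "(\<integral>\<^sup>+\<xi>. \<integral>\<^sup>+s. ennreal (norm (?f \<xi> s)) \<partial>lborel \<partial>lborel) < \<infinity>"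
      using riesz_finite(2)[OF a an] q_nonneg by (simp add: norm_mult abs_mult)
    moreover have "(\<lambda>(\<xi>, s). ?f \<xi> s) \<in> borel_measurable (lborel \<Otimes>\<^sub>M lborel)"
      by measurable
    ultimately have "(\<integral>\<xi>. \<integral>s. ?f \<xi> s \<partial>lborel \<partial>lborel) = (\<integral>s. \<integral>\<xi>. ?f \<xi> s \<partial>lborel \<partial>lborel)"
      using lborel_pair.Fubini_nn_bounded(1)[of ?f] by simp
    also have "(\<integral>\<xi>. \<integral>s. ?f \<xi> s \<partial>lborel \<partial>lborel) =
        (\<integral>\<xi>. complex_of_real (Gamma a) * (complex_of_real (q \<xi> * norm \<xi> powr (- 2 * a)) * iexp (- (x \<bullet> \<xi>))) \<partial>lborel)"
    proof (rule integral_cong_AE, measurable, rule AE_mp[OF AE_lborel_singleton[of 0]], rule AE_I2, rule impI)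
      fix \<xi> :: 'a assume "\<xi> \<noteq> 0"
      have "(\<integral>s. ?w s * exp (- s * (norm \<xi>)\<^sup>2) \<partial>lborel) = Gamma a * ((norm \<xi>)\<^sup>2) powr - a"
        using gamma_mixture[OF a, of "(norm \<xi>)\<^sup>2"] \<open>\<xi> \<noteq> 0\<close> G by (subst integral_eq_nn_integral) auto
      also have "((norm \<xi>)\<^sup>2) powr - a = norm \<xi> powr (- 2 * a)"
        using \<open>\<xi> \<noteq> 0\<close> by (simp add: powr_powr flip: powr_numeral)
      finally have I: "(\<integral>s. ?w s * exp (- s * (norm \<xi>)\<^sup>2) \<partial>lborel) = Gamma a * norm \<xi> powr (- 2 * a)" .
      have "(\<integral>s. ?f \<xi> s \<partial>lborel) = (\<integral>s. complex_of_real (?w s * exp (- s * (norm \<xi>)\<^sup>2)) * (q \<xi> * iexp (- (x \<bullet> \<xi>))) \<partial>lborel)"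
        by (intro Bochner_Integration.integral_cong refl) simp
      also have "\<dots> = complex_of_real (Gamma a * norm \<xi> powr (- 2 * a)) * (q \<xi> * iexp (- (x \<bullet> \<xi>)))"
        unfolding integral_mult_left_zero integral_complex_of_real I ..
      finally show "(\<integral>s. ?f \<xi> s \<partial>lborel) =
          complex_of_real (Gamma a) * (complex_of_real (q \<xi> * norm \<xi> powr (- 2 * a)) * iexp (- (x \<bullet> \<xi>)))"
        by simp
    qed
    also have "(\<integral>s. \<integral>\<xi>. ?f \<xi> s \<partial>lborel \<partial>lborel) =
        (\<integral>s. complex_of_real (gauss_const 1 * (indicator {0<..} s * s powr (- b - 1) * gauss_smooth s x)) \<partial>lborel)"
    proof (intro Bochner_Integration.integral_cong refl)
      fix s :: real
      show "(\<integral>\<xi>. ?f \<xi> s \<partial>lborel) = complex_of_real (gauss_const 1 * (indicator {0<..} s * s powr (- b - 1) * gauss_smooth s x))"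
      proof (cases "0 < s")
        case True
        have "(\<integral>\<xi>. ?f \<xi> s \<partial>lborel) = (\<integral>\<xi>. complex_of_real (s powr (a - 1)) *
            (complex_of_real (exp (- s * (norm \<xi>)\<^sup>2) * q \<xi>) * iexp (- (x \<bullet> \<xi>))) \<partial>lborel)"
          using True by (intro Bochner_Integration.integral_cong refl) simp
        also have "\<dots> = complex_of_real (s powr (a - 1)) * complex_of_real (gauss_const s * gauss_smooth s x)"
          using gaussian_transform[OF True, of x] unfolding integral_mult_right_zero
          by (simp only: has_bochner_integral_iff)
        also have "gauss_const s = gauss_const 1 * s powr (- real DIM('a) / 2)"
          by (rule gauss_const_powr[OF True])
        also have "complex_of_real (s powr (a - 1)) * complex_of_real (gauss_const 1 * s powr (- real DIM('a) / 2) * gauss_smooth s x)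
            = complex_of_real (gauss_const 1 * ((s powr (a - 1) * s powr (- real DIM('a) / 2)) * gauss_smooth s x))"
          by simp
        also have "s powr (a - 1) * s powr (- real DIM('a) / 2) = s powr (- b - 1)"
          unfolding powr_add[symmetric] b_def by (rule arg_cong[where f = "\<lambda>e. s powr e"]) simp
        finally show ?thesis using True by simp
      qed simp
    qed
    also have "\<dots> = complex_of_real (gauss_const 1 * (\<integral>s. indicator {0<..} s * s powr (- b - 1) * gauss_smooth s x \<partial>lborel))"
      by (simp only: integral_complex_of_real integral_mult_right_zero)
    \<comment> \<open>All factors are non-negative from here on, so \<open>s\<close> and
      \<open>y\<close> are interchanged by Tonelli. Both conversions through \<open>enn2real\<close>
      remain valid for an infinite value, which gives 0 on either side.\<close>
    also have "(\<integral>s. indicator {0<..} s * s powr (- b - 1) * gauss_smooth s x \<partial>lborel) =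
        enn2real (\<integral>\<^sup>+s. ennreal (indicator {0<..} s * s powr (- b - 1) * gauss_smooth s x) \<partial>lborel)"
      using gauss_smooth_nonneg by (intro integral_eq_nn_integral) auto
    also have "(\<integral>\<^sup>+s. ennreal (indicator {0<..} s * s powr (- b - 1) * gauss_smooth s x) \<partial>lborel) =
        (\<integral>\<^sup>+s. \<integral>\<^sup>+y. ennreal (indicator {0<..} s * s powr (- b - 1) * exp (- (norm (x - y))\<^sup>2 / (4 * s)) * \<rho> y) \<partial>lborel \<partial>lborel)"
    proof (rule nn_integral_cong)
      fix s :: real
      show "ennreal (indicator {0<..} s * s powr (- b - 1) * gauss_smooth s x) =
        (\<integral>\<^sup>+y. ennreal (indicator {0<..} s * s powr (- b - 1) * exp (- (norm (x - y))\<^sup>2 / (4 * s)) * \<rho> y) \<partial>lborel)"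
      proof (cases "0 < s")
        case True
        have "ennreal (s powr (- b - 1) * gauss_smooth s x) = ennreal (s powr (- b - 1)) * ennreal (gauss_smooth s x)"
          using gauss_smooth_nonneg by (intro ennreal_mult) auto
        also have "\<dots> = (\<integral>\<^sup>+y. ennreal (s powr (- b - 1)) * ennreal (\<rho> y * exp (- (norm (x - y))\<^sup>2 / (4 * s))) \<partial>lborel)"
          unfolding nn_gauss_smooth[OF True] by (subst nn_integral_cmult) auto
        finally show ?thesis
          using True nonneg by (simp add: ennreal_mult[symmetric] mult_ac)
      qed simp
    qed
    also have "\<dots> = (\<integral>\<^sup>+y. \<integral>\<^sup>+s. ennreal (indicator {0<..} s * s powr (- b - 1) * exp (- (norm (x - y))\<^sup>2 / (4 * s)) * \<rho> y) \<partial>lborel \<partial>lborel)"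
      by (rule lborel_pair.Fubini'[symmetric]) measurable
    also have "\<dots> = (\<integral>\<^sup>+y. ennreal (K * 4 powr b * (\<rho> y * (1 / norm (x - y) powr (real DIM('a) - 2 * a)))) \<partial>lborel)"
    \<comment> \<open>\<open>mix\<close> is applied with
      \<open>r = (norm (x - y))\<^sup>2 / 4\<close>, which is positive off the null set
      \<open>y = x\<close>.\<close>
    proof (rule nn_integral_cong_AE, rule AE_mp[OF AE_lborel_singleton[of x]], rule AE_I2, rule impI)
      fix y assume y: "y \<noteq> x"
      have "(\<integral>\<^sup>+s. ennreal (indicator {0<..} s * s powr (- b - 1) * exp (- (norm (x - y))\<^sup>2 / (4 * s)) * \<rho> y) \<partial>lborel)
        = (\<integral>\<^sup>+s. ennreal (indicator {0<..} s * s powr (- b - 1) * exp (- ((norm (x - y))\<^sup>2 / 4) / s)) \<partial>lborel) * ennreal (\<rho> y)"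
        using nonneg by (subst nn_integral_multc[symmetric]) (auto simp: ennreal_mult[symmetric])
      also have "\<dots> = ennreal (K * ((norm (x - y))\<^sup>2 / 4) powr - b) * ennreal (\<rho> y)"
        using y by (subst mix) auto
      also have "((norm (x - y))\<^sup>2 / 4) powr - b = 4 powr b * (1 / norm (x - y) powr (real DIM('a) - 2 * a))"
      proof -
        have "((norm (x - y))\<^sup>2) powr b = norm (x - y) powr (real DIM('a) - 2 * a)"
          using y by (simp add: powr_powr b_def algebra_simps flip: powr_numeral)
        then show ?thesis by (simp add: powr_divide powr_minus_divide)
      qed
      finally show "(\<integral>\<^sup>+s. ennreal (indicator {0<..} s * s powr (- b - 1) * exp (- (norm (x - y))\<^sup>2 / (4 * s)) * \<rho> y) \<partial>lborel)
        = ennreal (K * 4 powr b * (\<rho> y * (1 / norm (x - y) powr (real DIM('a) - 2 * a))))"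
        using nonneg K by (simp add: ennreal_mult[symmetric] mult_ac)
    qed
    also have "enn2real \<dots> = (\<integral>y. K * 4 powr b * (\<rho> y * (1 / norm (x - y) powr (real DIM('a) - 2 * a))) \<partial>lborel)"
      using nonneg K by (subst integral_eq_nn_integral) auto
    also have "\<dots> = K * 4 powr b * (\<integral>y. \<rho> y * (1 / norm (x - y) powr (real DIM('a) - 2 * a)) \<partial>lborel)"
      by (rule integral_mult_right_zero)
    also have "(\<integral>y. \<rho> y * (1 / norm (x - y) powr (real DIM('a) - 2 * a)) \<partial>lborel) =
        convolve \<rho> (\<lambda>y. 1 / norm y powr (real DIM('a) - 2 * a)) x"
      unfolding convolve_def by (subst integral_lborel_affine[where c = "-1" and t = x]) auto
    finally have "complex_of_real (Gamma a) *
        (\<integral>\<xi>. complex_of_real (q \<xi> * norm \<xi> powr (- 2 * a)) * iexp (- (x \<bullet> \<xi>)) \<partial>lborel) =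
        complex_of_real (gauss_const 1 * (K * 4 powr b * convolve \<rho> (\<lambda>y. 1 / norm y powr (real DIM('a) - 2 * a)) x))"
      by (simp only: integral_mult_right_zero)
    then show ?thesis using G by (simp add: C_def field_simps)
  qed
  then show ?thesis using C that by blast
qed

text \<open>The factor \<open>c\<close> is kept free so that a suitable normalisation can later
  match the spectral measure exactly.\<close>

definition riesz_measure :: "real \<Rightarrow> real \<Rightarrow> 'a measure" where
  "riesz_measure c a = density lborel (\<lambda>\<xi>. ennreal (c * (q \<xi> * norm \<xi> powr (- 2 * a))))"

lemma sets_riesz_measure[measurable_cong]: "sets (riesz_measure c a) = sets borel"
  by (simp add: riesz_measure_def)

lemma finite_riesz_measure:
  assumes "0 < a" "2 * a < real DIM('a)" and c: "0 \<le> c"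
  shows "finite_measure (riesz_measure c a)"
proof (rule finite_measureI)
  have "emeasure (riesz_measure c a) (space (riesz_measure c a)) =
      ennreal c * (\<integral>\<^sup>+\<xi>. ennreal (q \<xi> * norm \<xi> powr (- 2 * a)) \<partial>lborel)"
    using c q_nonneg by (simp add: riesz_measure_def emeasure_density ennreal_mult nn_integral_cmult)
  then show "emeasure (riesz_measure c a) (space (riesz_measure c a)) \<noteq> \<infinity>"
    using riesz_finite(1)[OF assms(1,2)] by (simp add: ennreal_mult_eq_top_iff)
qed

text \<open>\<open>C\<close> is fixed before \<open>c\<close> is chosen, which permits
  \<open>c = 1 / C\<close>.\<close>

lemma fourier_riesz_measure:
  assumes a: "0 < a" "2 * a < real DIM('a)"
  obtains C where "0 < C" and "\<And>c x. 0 \<le> c \<Longrightarrow> (\<integral>\<xi>. iexp (- (x \<bullet> \<xi>)) \<partial>riesz_measure c a) =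
    complex_of_real (c * C * convolve \<rho> (\<lambda>y. 1 / norm y powr (real DIM('a) - 2 * a)) x)"
proof -
  obtain C where C: "0 < C" and FT: "\<And>x. (\<integral>\<xi>. complex_of_real (q \<xi> * norm \<xi> powr (- 2 * a)) * iexp (- (x \<bullet> \<xi>)) \<partial>lborel)
    = complex_of_real (C * convolve \<rho> (\<lambda>y. 1 / norm y powr (real DIM('a) - 2 * a)) x)"
    using riesz_fourier[OF a] by blast
  have "(\<integral>\<xi>. iexp (- (x \<bullet> \<xi>)) \<partial>riesz_measure c a) =
    complex_of_real (c * C * convolve \<rho> (\<lambda>y. 1 / norm y powr (real DIM('a) - 2 * a)) x)" if c: "0 \<le> c" for c x
  proof -
    have "(\<integral>\<xi>. iexp (- (x \<bullet> \<xi>)) \<partial>riesz_measure c a) =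
        (\<integral>\<xi>. (c * (q \<xi> * norm \<xi> powr (- 2 * a))) *\<^sub>R iexp (- (x \<bullet> \<xi>)) \<partial>lborel)"
      unfolding riesz_measure_def using c q_nonneg by (subst integral_density) auto
    also have "\<dots> = (\<integral>\<xi>. complex_of_real c * (complex_of_real (q \<xi> * norm \<xi> powr (- 2 * a)) * iexp (- (x \<bullet> \<xi>))) \<partial>lborel)"
      by (intro Bochner_Integration.integral_cong refl) (simp add: scaleR_conv_of_real)
    finally show ?thesis
      unfolding integral_mult_right_zero FT by simp
  qed
  with C that show ?thesis by blast
qed

text \<open>The exponents add up. The identity of the densities is pointwise, including the origin,
  where every \<open>powr\<close> in it is 0.\<close>

lemma density_riesz_measure:
  assumes "0 \<le> c"
  shows "density (riesz_measure c a) (\<lambda>\<zeta>. ennreal (norm \<zeta> powr (2 * d))) = riesz_measure c (a - d)"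
  unfolding riesz_measure_def
proof (subst density_density_eq)
  show "density lborel (\<lambda>\<xi>. ennreal (c * (q \<xi> * norm \<xi> powr (- 2 * a))) * ennreal (norm \<xi> powr (2 * d))) =
      density lborel (\<lambda>\<xi>. ennreal (c * (q \<xi> * norm \<xi> powr (- 2 * (a - d)))))"
    using assms q_nonneg
    by (intro density_cong) (auto intro!: AE_I2 simp: ennreal_mult[symmetric] powr_add[symmetric] algebra_simps)
qed measurable

end

subsection \<open>Schwartz functions\<close>

lemma schwartz_continuous:
  assumes "schwartz u"
  shows "continuous_on UNIV u"
proof -
  have "u differentiable (at x)" for x
    using assms[unfolded schwartz_def, rule_format, of "[]"] by simp
  then show ?thesis
    by (intro continuous_at_imp_continuous_on ballI differentiable_imp_continuous_within)
qed

lemma schwartz_bounded: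
  assumes "schwartz u"
  obtains B where "\<And>x. norm x ^ k * norm (u x) \<le> B"
proof -
  have "bounded (range (\<lambda>x. norm x ^ k *\<^sub>R u x))"
    using assms[unfolded schwartz_def, rule_format, of "[]"] by simp
  then show ?thesis using that by (auto simp: bounded_iff)
qed

text \<open>Another Gamma mixture: with \<open>r = 1 + (norm x)\<^sup>2\<close>, integrating over
  \<open>x\<close> first leaves the Euler integral for
  \<open>Gamma (real DIM('a) / 2)\<close>.\<close>

lemma integrable_inverse_quadratic_power:
  "integrable lborel (\<lambda>x::'a::euclidean_space. (1 + (norm (x::'a))\<^sup>2) powr - real DIM('a))"
proof (rule integrableI_nonneg)
  let ?n = "real DIM('a)"
  let ?w = "\<lambda>s::real. indicator {0<..} s * s powr (?n - 1)"
  have G: "0 < Gamma ?n" by (intro Gamma_real_pos) simp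
  have "ennreal (Gamma ?n) * (\<integral>\<^sup>+x. ennreal ((1 + (norm (x::'a))\<^sup>2) powr - ?n) \<partial>lborel) =
      (\<integral>\<^sup>+x. \<integral>\<^sup>+s. ennreal (?w s * exp (- s * (1 + (norm (x::'a))\<^sup>2))) \<partial>lborel \<partial>lborel)"
    using G by (subst nn_integral_cmult[symmetric], measurable, intro nn_integral_cong, subst gamma_mixture)
      (auto simp: ennreal_mult add_pos_nonneg)
  also have "\<dots> = (\<integral>\<^sup>+s. \<integral>\<^sup>+x. ennreal (?w s * exp (- s * (1 + (norm (x::'a))\<^sup>2))) \<partial>lborel \<partial>lborel)"
    by (rule lborel_pair.Fubini') measurable
  also have "\<dots> = (\<integral>\<^sup>+s. ennreal (sqrt pi ^ DIM('a)) *
      ennreal (indicator {0<..} s * s powr (?n / 2 - 1) * exp (- s * 1)) \<partial>lborel)"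
  proof (rule nn_integral_cong)
    fix s :: real
    show "(\<integral>\<^sup>+x. ennreal (?w s * exp (- s * (1 + (norm (x::'a))\<^sup>2))) \<partial>lborel) =
      ennreal (sqrt pi ^ DIM('a)) * ennreal (indicator {0<..} s * s powr (?n / 2 - 1) * exp (- s * 1))"
    proof (cases "0 < s")
      case True
      have "(\<integral>\<^sup>+x. ennreal (?w s * exp (- s * (1 + (norm (x::'a))\<^sup>2))) \<partial>lborel) =
        ennreal (s powr (?n - 1) * exp (- s)) * (\<integral>\<^sup>+x. ennreal (exp (- s * (norm (x - (0::'a)))\<^sup>2)) \<partial>lborel)"
        using True by (subst nn_integral_cmult[symmetric])
          (auto simp: ennreal_mult[symmetric] algebra_simps exp_add[symmetric] exp_diff exp_minus divide_inverse)
      also have "\<dots> = ennreal (s powr (?n - 1) * exp (- s)) * ennreal (sqrt (pi / s) ^ DIM('a))"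
        using gaussian_integral[OF True, of "0::'a"] by simp
      also have "sqrt (pi / s) ^ DIM('a) = sqrt pi ^ DIM('a) * s powr (- ?n / 2)"
        using True
        by (simp add: real_sqrt_divide power_divide powr_minus_divide powr_half_sqrt[symmetric] powr_realpow[symmetric])
           (simp add: powr_powr)
      also have "ennreal (s powr (?n - 1) * exp (- s)) * ennreal (sqrt pi ^ DIM('a) * s powr (- ?n / 2)) =
          ennreal (sqrt pi ^ DIM('a)) * ennreal ((s powr (?n - 1) * s powr (- ?n / 2)) * exp (- s))"
        by (simp add: ennreal_mult[symmetric] mult_ac)
      also have "s powr (?n - 1) * s powr (- ?n / 2) = s powr (?n / 2 - 1)"
        unfolding powr_add[symmetric] by (rule arg_cong[where f = "\<lambda>e. s powr e"]) simp
      finally show ?thesis using True by simp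
    qed simp
  qed
  also have "\<dots> = ennreal (sqrt pi ^ DIM('a)) * ennreal (Gamma (?n / 2) * 1 powr - (?n / 2))"
    by (subst nn_integral_cmult, measurable, subst gamma_mixture) auto
  also have "\<dots> < \<infinity>" by (simp add: ennreal_mult_less_top)
  finally show "(\<integral>\<^sup>+x. ennreal ((1 + (norm (x::'a))\<^sup>2) powr - ?n) \<partial>lborel) < \<infinity>"
    using G by (auto simp: ennreal_mult_less_top)
qed auto

text \<open>The Schwartz bounds of orders 0 and \<open>2 * DIM('a)\<close> together dominate
  \<open>u\<close> by a multiple of the integrable function of the preceding lemma.\<close>

lemma schwartz_integrable:
  fixes u :: "'a::euclidean_space \<Rightarrow> 'b::{banach, second_countable_topology}"
  assumes "schwartz u"
  shows "integrable lborel u"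
proof -
  let ?n = "DIM('a)"
  obtain A where A: "\<And>x. norm x ^ 0 * norm (u x) \<le> A" using schwartz_bounded[OF assms] by blast
  obtain B where B: "\<And>x. norm x ^ (2 * ?n) * norm (u x) \<le> B" using schwartz_bounded[OF assms] by blast
  have [measurable]: "u \<in> borel_measurable borel"
    using schwartz_continuous[OF assms] by (rule borel_measurable_continuous_onI)
  have le: "norm (u x) \<le> 2 ^ ?n * (A + B) * (1 + (norm x)\<^sup>2) powr - real ?n" for x
  proof -
    let ?t = "(norm x)\<^sup>2"
    have "(1 + ?t) ^ ?n \<le> (2 * max 1 ?t) ^ ?n" by (intro power_mono) auto
    also have "\<dots> = 2 ^ ?n * max 1 ?t ^ ?n" by (rule power_mult_distrib)
    also have "max 1 ?t ^ ?n \<le> 1 + ?t ^ ?n" by (auto simp: max_def)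
    finally have "(1 + ?t) ^ ?n * norm (u x) \<le> 2 ^ ?n * (1 + ?t ^ ?n) * norm (u x)"
      by (auto intro!: mult_right_mono)
    also have "\<dots> = 2 ^ ?n * (norm x ^ 0 * norm (u x) + norm x ^ (2 * ?n) * norm (u x))"
      unfolding power_mult by (simp add: algebra_simps)
    also have "\<dots> \<le> 2 ^ ?n * (A + B)"
      by (intro mult_left_mono add_mono A B) auto
    finally show ?thesis
      by (simp add: powr_minus_divide powr_realpow add_pos_nonneg field_simps)
  qed
  have "integrable lborel (\<lambda>x::'a. 2 ^ ?n * (A + B) * (1 + (norm x)\<^sup>2) powr - real ?n)"
    by (intro integrable_mult_right integrable_inverse_quadratic_power)
  then show ?thesis
    by (rule Bochner_Integration.integrable_bound) (auto intro!: order_trans[OF le] mult_right_mono)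
qed

section \<open>Polynomials times Gaussians as Schwartz functions\<close>

inductive polynomial_map :: "('a::euclidean_space \<Rightarrow> complex) \<Rightarrow> bool" where
  const: "polynomial_map (\<lambda>_. c)"
| coord: "polynomial_map (\<lambda>x. complex_of_real (x \<bullet> v))"
| add: "polynomial_map p \<Longrightarrow> polynomial_map r \<Longrightarrow> polynomial_map (\<lambda>x. p x + r x)"
| mult: "polynomial_map p \<Longrightarrow> polynomial_map r \<Longrightarrow> polynomial_map (\<lambda>x. p x * r x)"

text \<open>The derivative has to be polynomial for each fixed direction \<open>v\<close>, because
  \<open>partials\<close> differentiates along one direction at a time. The sum and product rules
  stay within the clauses of \<open>polynomial_map\<close>.\<close>

lemma polynomial_map_derivative:
  assumes "polynomial_map p"
  shows "\<exists>p'. (\<forall>x. (p has_derivative p' x) (at x)) \<and> (\<forall>v. polynomial_map (\<lambda>x. p' x v))"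
  using assms
proof induction
  case (const c)
  show ?case by (intro exI[of _ "\<lambda>_ _. 0"]) (auto intro: polynomial_map.const)
next
  case (coord v)
  show ?case
    by (intro exI[of _ "\<lambda>_ h. complex_of_real (h \<bullet> v)"])
       (auto intro!: polynomial_map.const derivative_eq_intros)
next
  case (add p r)
  then obtain p' r' where "\<And>x. (p has_derivative p' x) (at x)" "\<And>v. polynomial_map (\<lambda>x. p' x v)"
    "\<And>x. (r has_derivative r' x) (at x)" "\<And>v. polynomial_map (\<lambda>x. r' x v)" by blast
  then show ?case
    by (intro exI[of _ "\<lambda>x h. p' x h + r' x h"]) (auto intro!: polynomial_map.add has_derivative_add)
next
  case (mult p r)
  then obtain p' r' where "\<And>x. (p has_derivative p' x) (at x)" "\<And>v. polynomial_map (\<lambda>x. p' x v)"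
    "\<And>x. (r has_derivative r' x) (at x)" "\<And>v. polynomial_map (\<lambda>x. r' x v)" by blast
  then show ?case using mult.hyps
    by (intro exI[of _ "\<lambda>x h. p x * r' x h + p' x h * r x"])
       (auto intro!: polynomial_map.add polynomial_map.mult has_derivative_mult)
qed

lemma polynomial_map_growth:
  assumes "polynomial_map p"
  shows "\<exists>C N. 0 \<le> C \<and> (\<forall>x. norm (p x) \<le> C * (1 + norm x) ^ N)"
  using assms
proof induction
  case (const c)
  show ?case by (intro exI[of _ "norm c"] exI[of _ 0]) auto
next
  case (coord v)
  have "\<bar>x \<bullet> v\<bar> \<le> norm v * (1 + norm x) ^ 1" for x
    using Cauchy_Schwarz_ineq2[of x v] by (simp add: algebra_simps add_increasing)
  then show ?case by (intro exI[of _ "norm v"] exI[of _ 1]) auto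
next
  case (add p r)
  then obtain C N D K where *: "0 \<le> C" "\<And>x. norm (p x) \<le> C * (1 + norm x) ^ N"
    "0 \<le> D" "\<And>x. norm (r x) \<le> D * (1 + norm x) ^ K" by blast
  have "norm (p x + r x) \<le> (C + D) * (1 + norm x) ^ (max N K)" for x
  proof -
    have "norm (p x + r x) \<le> C * (1 + norm x) ^ N + D * (1 + norm x) ^ K"
      by (intro norm_triangle_le add_mono *)
    also have "\<dots> \<le> C * (1 + norm x) ^ (max N K) + D * (1 + norm x) ^ (max N K)"
      using * by (intro add_mono mult_left_mono power_increasing) auto
    finally show ?thesis by (simp add: algebra_simps)
  qed
  then show ?case using * by (intro exI[of _ "C + D"] exI[of _ "max N K"]) auto
next
  case (mult p r)
  then obtain C N D K where *: "0 \<le> C" "\<And>x. norm (p x) \<le> C * (1 + norm x) ^ N"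
    "0 \<le> D" "\<And>x. norm (r x) \<le> D * (1 + norm x) ^ K" by blast
  have "norm (p x * r x) \<le> (C * D) * (1 + norm x) ^ (N + K)" for x
    using mult_mono[OF *(2)[of x] *(4)[of x]] * by (simp add: norm_mult power_add mult_ac)
  then show ?case using * by (intro exI[of _ "C * D"] exI[of _ "N + K"]) auto
qed

text \<open>From \<open>1 + r \<le> 2 + 2 * r\<^sup>2\<close> the Gaussian is at most a multiple of
  \<open>exp (- (t * (1 + r) / 2))\<close>, and the exponential absorbs the power.\<close>

lemma gaussian_decay:
  assumes t: "0 < (t::real)"
  obtains C where "0 < C" and "\<And>r. 0 \<le> r \<Longrightarrow> (1 + r) ^ k * exp (- t * r\<^sup>2) \<le> C"
proof
  let ?C = "exp t * ((2 / t) ^ k * fact k)"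
  show "0 < ?C" using t by auto
  fix r :: real assume r: "0 \<le> r"
  have "(1 + r) \<le> (1 + r)\<^sup>2" using r by (simp add: power2_eq_square)
  also have "\<dots> \<le> 2 + 2 * r\<^sup>2" using sum_squares_ge_zero[of "1 - r" 0] by (simp add: power2_eq_square algebra_simps)
  finally have "t * (1 + r) \<le> t * (2 + 2 * r\<^sup>2)" using t by simp
  then have "- t * r\<^sup>2 \<le> t - t * (1 + r) / 2" by (simp add: algebra_simps)
  then have "exp (- t * r\<^sup>2) \<le> exp t * exp (- (t * (1 + r) / 2))" by (simp flip: exp_add)
  then have "(1 + r) ^ k * exp (- t * r\<^sup>2) \<le> (1 + r) ^ k * (exp t * exp (- (t * (1 + r) / 2)))"
    using r by (intro mult_left_mono) auto
  also have "\<dots> = exp t * ((2 / t) ^ k * ((t * (1 + r) / 2) ^ k * exp (- (t * (1 + r) / 2))))"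
  proof -
    have "(2 / t) ^ k * (t * (1 + r) / 2) ^ k = (1 + r) ^ k"
      unfolding power_mult_distrib[symmetric] using t
      by (intro arg_cong[where f = "\<lambda>u. u ^ k"]) (simp add: field_simps)
    then show ?thesis by (metis mult.assoc mult.left_commute)
  qed
  also have "\<dots> \<le> ?C"
    using t r power_le_fact_exp[of "t * (1 + r) / 2" k]
    by (intro mult_left_mono) (auto simp: exp_minus field_simps)
  finally show "(1 + r) ^ k * exp (- t * r\<^sup>2) \<le> ?C" .
qed

text \<open>The test functions of the uniqueness argument: their Fourier transforms are, up to
  constants, the real Gaussians of every centre \<open>b\<close> and every width.\<close>

definition modulated_gaussian :: "'a::euclidean_space \<Rightarrow> real \<Rightarrow> 'a \<Rightarrow> complex" where
  "modulated_gaussian b t x = complex_of_real (exp (- t * (norm x)\<^sup>2)) * iexp (b \<bullet> x)"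

lemma modulated_gaussian_derivative:
  "(modulated_gaussian b t has_derivative
     (\<lambda>h. modulated_gaussian b t x * (\<i> * complex_of_real (h \<bullet> b) + complex_of_real (- 2 * t) * complex_of_real (x \<bullet> h)))) (at x)"
proof -
  have eq: "modulated_gaussian b t = (\<lambda>x. exp (- complex_of_real t * complex_of_real (x \<bullet> x) + \<i> * complex_of_real (b \<bullet> x)))"
    by (auto simp: modulated_gaussian_def fun_eq_iff power2_norm_eq_inner exp_of_real[symmetric] exp_add[symmetric])
  show ?thesis
    unfolding eq
    by (rule has_derivative_eq_rhs[OF has_derivative_compose[OF _ DERIV_exp[unfolded has_field_derivative_def]]])
       (auto intro!: derivative_eq_intros simp: fun_eq_iff inner_commute algebra_simps)
qed

text \<open>By the product rule, each further derivative only replaces the polynomial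
  factor.\<close>

lemma partials_modulated_gaussian:
  "\<exists>r. polynomial_map r \<and> partials bs (modulated_gaussian b t) = (\<lambda>x. r x * modulated_gaussian b t x)"
proof (induction bs)
  case Nil
  show ?case by (intro exI[of _ "\<lambda>_. 1"]) (auto intro: polynomial_map.const)
next
  case (Cons v bs)
  then obtain r where r: "polynomial_map r"
    and eq: "partials bs (modulated_gaussian b t) = (\<lambda>x. r x * modulated_gaussian b t x)" by blast
  obtain r' where r': "\<And>x. (r has_derivative r' x) (at x)" "\<And>v. polynomial_map (\<lambda>x. r' x v)"
    using polynomial_map_derivative[OF r] by blast
  let ?s = "\<lambda>x. r x * (\<i> * complex_of_real (v \<bullet> b) + complex_of_real (- 2 * t) * complex_of_real (x \<bullet> v)) + r' x v"
  have "frechet_derivative (\<lambda>x. r x * modulated_gaussian b t x) (at x) v = ?s x * modulated_gaussian b t x" for x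
    by (subst frechet_derivative_at[OF has_derivative_mult[OF r'(1) modulated_gaussian_derivative], symmetric])
       (simp add: algebra_simps)
  moreover have "polynomial_map ?s"
    by (intro polynomial_map.intros r r')
  ultimately show ?case
    by (intro exI[of _ ?s]) (simp add: eq)
qed

lemma schwartz_modulated_gaussian:
  assumes t: "0 < t"
  shows "schwartz (modulated_gaussian b t)"
  unfolding schwartz_def
proof (intro allI impI conjI)
  fix bs :: "'a list" and x :: 'a and k :: nat
  obtain r where r: "polynomial_map r"
    and eq: "partials bs (modulated_gaussian b t) = (\<lambda>x. r x * modulated_gaussian b t x)"
    using partials_modulated_gaussian by blast
  obtain r' where r': "\<And>x. (r has_derivative r' x) (at x)"
    using polynomial_map_derivative[OF r] by blast
  show "partials bs (modulated_gaussian b t) differentiable (at x)"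
    unfolding eq differentiable_def
    using has_derivative_mult[OF r' modulated_gaussian_derivative] by blast
  obtain C N where C: "0 \<le> C" "\<And>x. norm (r x) \<le> C * (1 + norm x) ^ N"
    using polynomial_map_growth[OF r] by blast
  \<comment> \<open>The exponent accounts for the weight \<open>norm y ^ k\<close> and for the
    growth of \<open>r\<close> of order \<open>N\<close>.\<close>
  obtain D where D: "\<And>s. 0 \<le> s \<Longrightarrow> (1 + s) ^ (k + N) * exp (- t * s\<^sup>2) \<le> D"
    using gaussian_decay[OF t] by blast
  have "norm (norm y ^ k *\<^sub>R (r y * modulated_gaussian b t y)) \<le> C * D" for y
  proof -
    have "norm (norm y ^ k *\<^sub>R (r y * modulated_gaussian b t y)) = norm y ^ k * (norm (r y) * exp (- t * (norm y)\<^sup>2))"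
      by (simp add: modulated_gaussian_def norm_mult)
    also have "\<dots> \<le> (1 + norm y) ^ k * ((C * (1 + norm y) ^ N) * exp (- t * (norm y)\<^sup>2))"
      using C by (intro mult_mono power_mono) auto
    also have "\<dots> = C * ((1 + norm y) ^ (k + N) * exp (- t * (norm y)\<^sup>2))"
      by (simp add: power_add mult_ac)
    also have "\<dots> \<le> C * D" using C(1) D[of "norm y"] by (intro mult_left_mono) auto
    finally show ?thesis .
  qed
  then show "bounded (range (\<lambda>x. norm x ^ k *\<^sub>R partials bs (modulated_gaussian b t) x))"
    unfolding eq bounded_iff by blast
qed

lemma fourier_modulated_gaussian:
  fixes b :: "'a::euclidean_space"
  assumes t: "0 < t"
  shows "fourier (modulated_gaussian b t) \<xi> =
    complex_of_real (sqrt (pi / t) ^ DIM('a) * exp (- (1 / (4 * t)) * (norm (\<xi> - b))\<^sup>2))"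
proof -
  have "modulated_gaussian b t x * exp (- \<i> * complex_of_real (\<xi> \<bullet> x)) =
      complex_of_real (exp (- t * (norm x)\<^sup>2)) * iexp ((b - \<xi>) \<bullet> x)" for x
    by (simp add: modulated_gaussian_def inner_diff_left algebra_simps flip: exp_add)
  then show ?thesis
    using gaussian_fourier[OF t, of "b - \<xi>"]
    by (simp add: fourier_def has_bochner_integral_iff norm_minus_commute)
qed

subsection \<open>Finite measures and their Fourier transforms\<close>

text \<open>Fubini for \<open>\<phi> x * iexp (- (x \<bullet> \<xi>))\<close>, whose norm is that of
  \<open>\<phi> x\<close> and hence integrable against the product with a finite measure.\<close>

lemma fourier_finite_measure:
  fixes \<nu> :: "'a::euclidean_space measure"
  assumes "finite_measure \<nu>" and sets[measurable_cong]: "sets \<nu> = sets borel"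
    and int: "integrable lborel \<phi>"
  shows "has_bochner_integral lborel (\<lambda>x. (\<integral>\<xi>. iexp (- (x \<bullet> \<xi>)) \<partial>\<nu>) * \<phi> x) (\<integral>\<xi>. fourier \<phi> \<xi> \<partial>\<nu>)"
proof -
  interpret finite_measure \<nu> by fact
  interpret P: pair_sigma_finite lborel \<nu> ..
  have [measurable]: "\<phi> \<in> borel_measurable borel" using int by auto
  let ?f = "\<lambda>x \<xi>. \<phi> x * iexp (- (x \<bullet> \<xi>))"
  have "(\<integral>\<^sup>+x. \<integral>\<^sup>+\<xi>. ennreal (norm (?f x \<xi>)) \<partial>\<nu> \<partial>lborel) = (\<integral>\<^sup>+x. ennreal (norm (\<phi> x)) \<partial>lborel) * emeasure \<nu> (space \<nu>)"
    by (simp add: norm_mult nn_integral_multc)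
  also have "\<dots> < \<infinity>"
    using int by (auto simp: integrable_iff_bounded ennreal_mult_less_top less_top emeasure_eq_measure)
  finally have "(\<integral>\<^sup>+x. \<integral>\<^sup>+\<xi>. ennreal (norm (?f x \<xi>)) \<partial>\<nu> \<partial>lborel) < \<infinity>" .
  moreover have "(\<lambda>(x, \<xi>). ?f x \<xi>) \<in> borel_measurable (lborel \<Otimes>\<^sub>M \<nu>)" by measurable
  ultimately have F: "(\<integral>\<xi>. \<integral>x. ?f x \<xi> \<partial>lborel \<partial>\<nu>) = (\<integral>x. \<integral>\<xi>. ?f x \<xi> \<partial>\<nu> \<partial>lborel)"
      "integrable lborel (\<lambda>x. \<integral>\<xi>. ?f x \<xi> \<partial>\<nu>)"
    using P.Fubini_nn_bounded[of ?f] by blast+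
  have "fourier \<phi> \<xi> = (\<integral>x. ?f x \<xi> \<partial>lborel)" for \<xi>
    by (simp add: fourier_def inner_commute)
  with F show ?thesis
    by (simp add: has_bochner_integral_iff mult.commute)
qed

text \<open>For a finite measure the pointwise Fourier transform is also the one defined by test
  functions. It is bounded by the total mass, hence locally integrable.\<close>

lemma has_fourier_transform_finite_measure:
  fixes \<nu> :: "'a::euclidean_space measure" and g :: "'a \<Rightarrow> real"
  assumes "finite_measure \<nu>" and sets[measurable_cong]: "sets \<nu> = sets borel"
    and g: "\<And>x. (\<integral>\<xi>. iexp (- (x \<bullet> \<xi>)) \<partial>\<nu>) = complex_of_real (g x)"
  shows "has_fourier_transform \<nu> (\<lambda>x. complex_of_real (g x))" and "locally_integrable g"
proof -
  interpret finite_measure \<nu> by fact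
  have "tempered_measure \<nu>"
    unfolding tempered_measure_def using sets by (auto intro!: exI[of _ 0] simp: emeasure_eq_measure)
  then show "has_fourier_transform \<nu> (\<lambda>x. complex_of_real (g x))"
    unfolding has_fourier_transform_def g[symmetric]
    using fourier_finite_measure[OF assms(1) sets] schwartz_integrable by blast
  have "g = (\<lambda>x. Re (\<integral>\<xi>. iexp (- (x \<bullet> \<xi>)) \<partial>\<nu>))" using g by simp
  also have "\<dots> \<in> borel_measurable borel" by measurable
  finally have [measurable]: "g \<in> borel_measurable borel" .
  have "\<bar>g x\<bar> \<le> measure \<nu> (space \<nu>)" for x
  proof -
    have "\<bar>g x\<bar> = norm (\<integral>\<xi>. iexp (- (x \<bullet> \<xi>)) \<partial>\<nu>)" unfolding g by simp
    also have "\<dots> \<le> (\<integral>\<xi>. norm (iexp (- (x \<bullet> \<xi>))) \<partial>\<nu>)" by (rule integral_norm_bound)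
    finally show ?thesis by simp
  qed
  note bound = this
  show "locally_integrable g"
    unfolding locally_integrable_def set_integrable_def
  proof (intro allI impI)
    fix K :: "'a set" assume "compact K"
    then have [measurable]: "K \<in> sets borel" and "emeasure lborel K < \<infinity>"
      by (rule borel_compact, rule emeasure_compact_finite)
    then have "integrable lborel (\<lambda>x. measure \<nu> (space \<nu>) * indicator K x)"
      by (intro integrable_mult_right integrable_real_indicator) auto
    then show "integrable lborel (\<lambda>x. indicator K x *\<^sub>R g x)"
      by (rule Bochner_Integration.integrable_bound) (auto simp: indicator_def bound)
  qed
qed

text \<open>Smoothing \<open>h\<close> by Gaussians expresses its integral as a limit of
  superpositions of Gaussian integrals, on which \<open>M\<close> and \<open>N\<close> agree. The
  bound \<open>h x \<le> 1\<close> and the finiteness of the measures justify the limits by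
  dominated convergence.\<close>

lemma nn_integral_continuous_eq:
  fixes M N :: "'a::euclidean_space measure" and h :: "'a \<Rightarrow> real"
  assumes "finite_measure M" "finite_measure N"
    and sets[measurable_cong]: "sets M = sets borel" "sets N = sets borel"
    and eq: "\<And>\<tau> b. 0 < \<tau> \<Longrightarrow> (\<integral>\<^sup>+\<xi>. ennreal (exp (- \<tau> * (norm (\<xi> - b))\<^sup>2)) \<partial>M) = (\<integral>\<^sup>+\<xi>. ennreal (exp (- \<tau> * (norm (\<xi> - b))\<^sup>2)) \<partial>N)"
    and h: "continuous_on UNIV h" "\<And>x. 0 \<le> h x" "\<And>x. h x \<le> 1"
  shows "(\<integral>\<^sup>+\<xi>. ennreal (h \<xi>) \<partial>M) = (\<integral>\<^sup>+\<xi>. ennreal (h \<xi>) \<partial>N)"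
proof -
  have [measurable]: "h \<in> borel_measurable borel" using h(1) by (rule borel_measurable_continuous_onI)
  \<comment> \<open>The average of \<open>h\<close> around \<open>\<xi>\<close> at scale
    \<open>c\<close>, against an unnormalised Gaussian of total mass \<open>k\<close>. It tends to
    \<open>k * h \<xi>\<close> as \<open>c\<close> tends to 0.\<close>
  define P where "P c \<xi> = (\<integral>\<^sup>+z. ennreal (h (\<xi> + c *\<^sub>R z) * exp (- (norm z)\<^sup>2)) \<partial>lborel)" for c \<xi>
  define k where "k = sqrt pi ^ DIM('a)"
  have k: "0 < k" by (simp add: k_def)
  have gauss: "(\<integral>\<^sup>+z. ennreal (exp (- (norm z)\<^sup>2)) \<partial>(lborel :: 'a measure)) = ennreal k"
    using gaussian_integral[of 1 "0::'a"] by (simp add: k_def)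
  have [measurable]: "P c \<in> borel_measurable borel" for c
    unfolding P_def by measurable
  have P_le: "P c \<xi> \<le> ennreal k" for c \<xi>
    unfolding gauss[symmetric] P_def using h by (intro nn_integral_mono ennreal_leI) (auto simp: mult_left_le_one_le)
  have P_lim: "(\<lambda>i. P (1 / real (Suc i)) \<xi>) \<longlonglongrightarrow> ennreal (k * h \<xi>)" for \<xi>
  proof -
    have "(\<lambda>i. \<integral>\<^sup>+z. ennreal (h (\<xi> + (1 / real (Suc i)) *\<^sub>R z) * exp (- (norm z)\<^sup>2)) \<partial>lborel)
        \<longlonglongrightarrow> (\<integral>\<^sup>+z. ennreal (h \<xi> * exp (- (norm z)\<^sup>2)) \<partial>(lborel :: 'a measure))"
    proof (rule nn_integral_dominated_convergence[where w = "\<lambda>z::'a. ennreal (exp (- (norm z)\<^sup>2))"])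
      show "(\<integral>\<^sup>+z. ennreal (exp (- (norm z)\<^sup>2)) \<partial>(lborel :: 'a measure)) < \<infinity>" unfolding gauss by simp
      show "AE z in lborel. (\<lambda>i. ennreal (h (\<xi> + (1 / real (Suc i)) *\<^sub>R z) * exp (- (norm z)\<^sup>2))) \<longlonglongrightarrow> ennreal (h \<xi> * exp (- (norm z)\<^sup>2))"
      proof (intro AE_I2 tendsto_ennrealI tendsto_mult tendsto_const)
        fix z
        have "(\<lambda>i. \<xi> + (1 / real (Suc i)) *\<^sub>R z) \<longlonglongrightarrow> \<xi> + 0 *\<^sub>R z"
          by (intro tendsto_intros LIMSEQ_inverse_real_of_nat[unfolded inverse_eq_divide])
        then have "(\<lambda>i. \<xi> + (1 / real (Suc i)) *\<^sub>R z) \<longlonglongrightarrow> \<xi>" by simp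
        then show "(\<lambda>i. h (\<xi> + (1 / real (Suc i)) *\<^sub>R z)) \<longlonglongrightarrow> h \<xi>"
          using h(1) by (intro continuous_on_tendsto_compose[OF h(1)]) auto
      qed
    qed (use h in \<open>auto intro!: ennreal_leI simp: mult_left_le_one_le\<close>)
    also have "(\<integral>\<^sup>+z. ennreal (h \<xi> * exp (- (norm z)\<^sup>2)) \<partial>(lborel :: 'a measure)) = ennreal (k * h \<xi>)"
      using h k by (simp add: ennreal_mult nn_integral_cmult gauss mult.commute)
    finally show ?thesis unfolding P_def .
  qed
  have lim: "(\<lambda>i. \<integral>\<^sup>+\<xi>. P (1 / real (Suc i)) \<xi> \<partial>L) \<longlonglongrightarrow> ennreal k * (\<integral>\<^sup>+\<xi>. ennreal (h \<xi>) \<partial>L)"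
    if "finite_measure L" and [measurable_cong]: "sets L = sets borel" for L
  proof -
    interpret finite_measure L by fact
    have "(\<lambda>i. \<integral>\<^sup>+\<xi>. P (1 / real (Suc i)) \<xi> \<partial>L) \<longlonglongrightarrow> (\<integral>\<^sup>+\<xi>. ennreal (k * h \<xi>) \<partial>L)"
      by (rule nn_integral_dominated_convergence[where w = "\<lambda>_::'a. ennreal k"])
         (auto simp: P_le ennreal_mult_less_top emeasure_eq_measure simp del: of_nat_Suc intro!: AE_I2 P_lim)
    then show ?thesis
      using k h by (simp add: ennreal_mult nn_integral_cmult)
  qed
  \<comment> \<open>The factor \<open>c ^ DIM('a)\<close> is the Jacobian of
    \<open>b = \<xi> + c *\<^sub>R z\<close>. On the right, \<open>L\<close> enters only through its
    Gaussian integrals.\<close>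
  have P_eq: "ennreal (c ^ DIM('a)) * (\<integral>\<^sup>+\<xi>. P c \<xi> \<partial>L) =
      (\<integral>\<^sup>+b. ennreal (h b) * (\<integral>\<^sup>+\<xi>. ennreal (exp (- (1 / c\<^sup>2) * (norm (\<xi> - b))\<^sup>2)) \<partial>L) \<partial>lborel)"
    if "finite_measure L" and [measurable_cong]: "sets L = sets borel" and c: "0 < c" for L c
  proof -
    interpret finite_measure L by fact
    interpret Q: pair_sigma_finite L lborel ..
    have "(\<integral>\<^sup>+b. ennreal (h b) * (\<integral>\<^sup>+\<xi>. ennreal (exp (- (1 / c\<^sup>2) * (norm (\<xi> - b))\<^sup>2)) \<partial>L) \<partial>lborel) =
        (\<integral>\<^sup>+b. \<integral>\<^sup>+\<xi>. ennreal (h b * exp (- (1 / c\<^sup>2) * (norm (\<xi> - b))\<^sup>2)) \<partial>L \<partial>lborel)"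
      using h by (subst nn_integral_cmult[symmetric]) (auto simp: ennreal_mult)
    also have "\<dots> = (\<integral>\<^sup>+\<xi>. \<integral>\<^sup>+b. ennreal (h b * exp (- (1 / c\<^sup>2) * (norm (\<xi> - b))\<^sup>2)) \<partial>lborel \<partial>L)"
      by (rule Q.Fubini') measurable
    also have "\<dots> = (\<integral>\<^sup>+\<xi>. ennreal (c ^ DIM('a)) * P c \<xi> \<partial>L)"
    proof (rule nn_integral_cong)
      fix \<xi>
      show "(\<integral>\<^sup>+b. ennreal (h b * exp (- (1 / c\<^sup>2) * (norm (\<xi> - b))\<^sup>2)) \<partial>lborel) = ennreal (c ^ DIM('a)) * P c \<xi>"
        unfolding P_def using c
        by (subst nn_integral_lborel_affine[where c = c and t = \<xi>]) (auto simp: power_mult_distrib)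
    qed
    also have "\<dots> = ennreal (c ^ DIM('a)) * (\<integral>\<^sup>+\<xi>. P c \<xi> \<partial>L)"
      by (subst nn_integral_cmult) auto
    finally show ?thesis ..
  qed
  have "(\<integral>\<^sup>+\<xi>. P (1 / real (Suc i)) \<xi> \<partial>M) = (\<integral>\<^sup>+\<xi>. P (1 / real (Suc i)) \<xi> \<partial>N)" for i
  proof -
    let ?c = "1 / real (Suc i)"
    have "ennreal (?c ^ DIM('a)) * (\<integral>\<^sup>+\<xi>. P ?c \<xi> \<partial>M) = ennreal (?c ^ DIM('a)) * (\<integral>\<^sup>+\<xi>. P ?c \<xi> \<partial>N)"
      by (simp only: P_eq[OF assms(1) sets(1), of ?c] P_eq[OF assms(2) sets(2), of ?c] eq zero_less_divide_iff zero_less_one of_nat_0_less_iff zero_less_Suc zero_less_power simp_thms)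
    then show ?thesis
      by (subst (asm) ennreal_mult_cancel_left) auto
  qed
  then have "ennreal k * (\<integral>\<^sup>+\<xi>. ennreal (h \<xi>) \<partial>M) = ennreal k * (\<integral>\<^sup>+\<xi>. ennreal (h \<xi>) \<partial>N)"
    using lim[OF assms(1) sets(1)] lim[OF assms(2) sets(2)] by (intro LIMSEQ_unique) auto
  then show ?thesis
    using k by (subst (asm) ennreal_mult_cancel_left) auto
qed

text \<open>Closed sets form an intersection-stable generator of the Borel sets, and the indicator
  of a closed set is a pointwise limit of continuous functions with values between 0 and 1.\<close>

lemma finite_measure_eqI_gaussian:
  fixes M N :: "'a::euclidean_space measure"
  assumes "finite_measure M" "finite_measure N"
    and sets[measurable_cong]: "sets M = sets borel" "sets N = sets borel"
    and eq: "\<And>\<tau> b. 0 < \<tau> \<Longrightarrow> (\<integral>\<^sup>+\<xi>. ennreal (exp (- \<tau> * (norm (\<xi> - b))\<^sup>2)) \<partial>M) = (\<integral>\<^sup>+\<xi>. ennreal (exp (- \<tau> * (norm (\<xi> - b))\<^sup>2)) \<partial>N)"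
  shows "M = N"
proof (rule measure_eqI_generator_eq[where E = "Collect closed" and \<Omega> = UNIV and A = "\<lambda>_. UNIV"])
  show "Int_stable (Collect (closed :: 'a set \<Rightarrow> bool))" by (auto simp: Int_stable_def)
  show "sets M = sigma_sets UNIV (Collect closed)" "sets N = sigma_sets UNIV (Collect closed)"
    unfolding sets by (simp_all add: borel_eq_closed)
  show "emeasure M UNIV \<noteq> \<infinity>"
    using finite_measure.emeasure_finite[OF assms(1)] by simp
  fix F :: "'a set" assume "F \<in> Collect closed"
  then have F: "closed F" by simp
  show "emeasure M F = emeasure N F"
  proof (cases "F = {}")
    case False
    \<comment> \<open>A cut-off that is 1 on \<open>F\<close> and, for \<open>i > 0\<close>,
      vanishes at distance \<open>1 / i\<close> and beyond. The empty set is treated apart because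
      \<open>infdist x {}\<close> is 0 by convention.\<close>
    define h where "h i x = max 0 (1 - real i * infdist x F)" for i x
    have h: "continuous_on UNIV (h i)" "0 \<le> h i x" "h i x \<le> 1" for i x
      unfolding h_def using infdist_nonneg[of x F] by (auto intro!: continuous_intros)
    have [measurable]: "h i \<in> borel_measurable borel" for i
      using h(1) by (rule borel_measurable_continuous_onI)
    have lim: "(\<lambda>i. ennreal (h i x)) \<longlonglongrightarrow> indicator F x" for x
    proof (cases "x \<in> F")
      case True
      then show ?thesis by (simp add: h_def)
    next
      case out: False
      then have pos: "0 < infdist x F"
        using F False in_closed_iff_infdist_zero[of F x] infdist_nonneg[of x F] by fastforce
      obtain j :: nat where j: "1 / infdist x F \<le> real j" using real_arch_simple by blast
      have "h i x = 0" if "i \<ge> j" for i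
      proof -
        have "1 / infdist x F \<le> real i" using j that by linarith
        then show ?thesis using pos by (simp add: h_def field_simps)
      qed
      then have "\<forall>\<^sub>F i in sequentially. ennreal (h i x) = 0"
        by (intro eventually_sequentiallyI[of j]) simp
      then show ?thesis using out by (simp add: tendsto_eventually)
    qed
    have conv: "(\<lambda>i. \<integral>\<^sup>+x. ennreal (h i x) \<partial>L) \<longlonglongrightarrow> emeasure L F"
      if "finite_measure L" and [measurable_cong]: "sets L = sets borel" for L
    proof -
      interpret finite_measure L by fact
      have [measurable]: "F \<in> sets L" using F that(2) by simp
      have "(\<lambda>i. \<integral>\<^sup>+x. ennreal (h i x) \<partial>L) \<longlonglongrightarrow> (\<integral>\<^sup>+x. indicator F x \<partial>L)"
        by (intro nn_integral_dominated_convergence[where w = "\<lambda>_::'a. 1"])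
          (auto simp: h lim emeasure_eq_measure)
      then show ?thesis using F that(2) by simp
    qed
    have "(\<integral>\<^sup>+x. ennreal (h i x) \<partial>M) = (\<integral>\<^sup>+x. ennreal (h i x) \<partial>N)" for i
      by (rule nn_integral_continuous_eq[OF assms(1,2) sets eq h])
    then show ?thesis
      using conv[OF assms(1) sets(1)] conv[OF assms(2) sets(2)] by (simp add: LIMSEQ_unique)
  qed simp
qed auto

text \<open>A Gaussian is dominated by the tempered weight. Moving its centre to \<open>b\<close>
  costs a factor \<open>(1 + norm b) ^ k\<close>, since
  \<open>1 + norm \<xi> \<le> (1 + norm b) * (1 + norm (\<xi> - b))\<close>.\<close>

lemma tempered_measure_integrable_gaussian:
  assumes \<nu>: "tempered_measure \<nu>" and \<tau>: "0 < \<tau>"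
  shows "integrable \<nu> (\<lambda>\<xi>. exp (- \<tau> * (norm (\<xi> - b))\<^sup>2))"
proof (rule integrableI_nonneg)
  obtain k where sets[measurable_cong]: "sets \<nu> = sets borel"
    and fin: "(\<integral>\<^sup>+x. ennreal (1 / (1 + norm x) ^ k) \<partial>\<nu>) < \<infinity>"
    using \<nu> by (auto simp: tempered_measure_def)
  show "(\<lambda>\<xi>. exp (- \<tau> * (norm (\<xi> - b))\<^sup>2)) \<in> borel_measurable \<nu>" by measurable
  obtain C where C: "0 < C" "\<And>r. 0 \<le> r \<Longrightarrow> (1 + r) ^ k * exp (- \<tau> * r\<^sup>2) \<le> C"
    using gaussian_decay[OF \<tau>] by blast
  let ?D = "(1 + norm b) ^ k * C"
  have "exp (- \<tau> * (norm (\<xi> - b))\<^sup>2) \<le> ?D * (1 / (1 + norm \<xi>) ^ k)" for \<xi>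
  proof -
    have "norm \<xi> \<le> norm b + norm (\<xi> - b)"
      using norm_triangle_ineq[of b "\<xi> - b"] by simp
    moreover have "0 \<le> norm b * norm (\<xi> - b)" by simp
    ultimately have "1 + norm \<xi> \<le> (1 + norm b) * (1 + norm (\<xi> - b))"
      by (simp add: algebra_simps del: mult_nonneg_nonneg)
    then have "(1 + norm \<xi>) ^ k \<le> (1 + norm b) ^ k * (1 + norm (\<xi> - b)) ^ k"
      unfolding power_mult_distrib[symmetric] by (intro power_mono) auto
    then have "(1 + norm \<xi>) ^ k * exp (- \<tau> * (norm (\<xi> - b))\<^sup>2) \<le>
        (1 + norm b) ^ k * (1 + norm (\<xi> - b)) ^ k * exp (- \<tau> * (norm (\<xi> - b))\<^sup>2)"
      by (intro mult_right_mono) auto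
    also have "\<dots> \<le> ?D"
      unfolding mult.assoc by (intro mult_left_mono C) auto
    finally show ?thesis by (simp add: pos_le_divide_eq add_pos_nonneg mult.commute)
  qed
  then have "(\<integral>\<^sup>+\<xi>. ennreal (exp (- \<tau> * (norm (\<xi> - b))\<^sup>2)) \<partial>\<nu>) \<le>
      (\<integral>\<^sup>+\<xi>. ennreal ?D * ennreal (1 / (1 + norm \<xi>) ^ k) \<partial>\<nu>)"
    using C by (intro nn_integral_mono) (simp add: ennreal_mult[symmetric] ennreal_leI)
  also have "\<dots> = ennreal ?D * (\<integral>\<^sup>+\<xi>. ennreal (1 / (1 + norm \<xi>) ^ k) \<partial>\<nu>)"
    by (rule nn_integral_cmult) measurable
  also have "\<dots> < \<infinity>" using fin by (simp add: ennreal_mult_less_top)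
  finally show "(\<integral>\<^sup>+\<xi>. ennreal (exp (- \<tau> * (norm (\<xi> - b))\<^sup>2)) \<partial>\<nu>) < \<infinity>" .
qed auto

lemma has_fourier_transform_gaussian_eq:
  fixes \<mu> \<nu> :: "'a::euclidean_space measure"
  assumes \<mu>: "has_fourier_transform \<mu> f" and \<nu>: "has_fourier_transform \<nu> f" and \<tau>: "0 < \<tau>"
  shows "(\<integral>\<^sup>+\<xi>. ennreal (exp (- \<tau> * (norm (\<xi> - b))\<^sup>2)) \<partial>\<mu>) = (\<integral>\<^sup>+\<xi>. ennreal (exp (- \<tau> * (norm (\<xi> - b))\<^sup>2)) \<partial>\<nu>)"
proof -
  \<comment> \<open>The width for which the transform of \<open>modulated_gaussian b t\<close>
    decays with rate \<open>\<tau>\<close>.\<close>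
  define t where "t = 1 / (4 * \<tau>)"
  have t: "0 < t" "1 / (4 * t) = \<tau>" using \<tau> by (auto simp: t_def)
  let ?k = "sqrt (pi / t) ^ DIM('a)"
  have "(\<integral>\<xi>. fourier (modulated_gaussian b t) \<xi> \<partial>\<mu>) = (\<integral>\<xi>. fourier (modulated_gaussian b t) \<xi> \<partial>\<nu>)"
    using \<mu> \<nu> schwartz_modulated_gaussian[OF t(1)]
    unfolding has_fourier_transform_def by (blast intro: has_bochner_integral_eq)
  then have "?k * (\<integral>\<xi>. exp (- \<tau> * (norm (\<xi> - b))\<^sup>2) \<partial>\<mu>) = ?k * (\<integral>\<xi>. exp (- \<tau> * (norm (\<xi> - b))\<^sup>2) \<partial>\<nu>)"
    unfolding fourier_modulated_gaussian[OF t(1)] t(2) integral_complex_of_real integral_mult_right_zero of_real_eq_iff .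
  then have "(\<integral>\<xi>. exp (- \<tau> * (norm (\<xi> - b))\<^sup>2) \<partial>\<mu>) = (\<integral>\<xi>. exp (- \<tau> * (norm (\<xi> - b))\<^sup>2) \<partial>\<nu>)"
    using t(1) by simp
  \<comment> \<open>Without integrability the integrals just compared could be the default 0; with
    it they equal the non-negative integrals.\<close>
  moreover have "integrable \<mu> (\<lambda>\<xi>. exp (- \<tau> * (norm (\<xi> - b))\<^sup>2))" "integrable \<nu> (\<lambda>\<xi>. exp (- \<tau> * (norm (\<xi> - b))\<^sup>2))"
    using \<mu> \<nu> \<tau> by (auto simp: has_fourier_transform_def intro!: tempered_measure_integrable_gaussian[simplified])
  ultimately show ?thesis
    by (simp add: nn_integral_eq_integral)
qed

text \<open>Finiteness of \<open>\<mu>\<close> is derived from that of \<open>\<nu>\<close>: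
  Gaussians increasingly flat have equal integrals against both measures, and Fatou's lemma bounds
  the mass of \<open>\<mu>\<close>. Then finite measures with equal Gaussian integrals
  coincide.\<close>

lemma has_fourier_transform_unique:
  fixes \<mu> \<nu> :: "'a::euclidean_space measure"
  assumes \<mu>: "has_fourier_transform \<mu> f" and \<nu>: "has_fourier_transform \<nu> f" and "finite_measure \<nu>"
  shows "\<mu> = \<nu>"
proof -
  interpret finite_measure \<nu> by fact
  have sets[measurable_cong]: "sets \<mu> = sets borel" "sets \<nu> = sets borel"
    using \<mu> \<nu> by (auto simp: has_fourier_transform_def tempered_measure_def)
  have space: "space \<mu> = UNIV" "space \<nu> = UNIV"
    using sets[THEN sets_eq_imp_space_eq] by auto
  let ?u = "\<lambda>i (\<xi>::'a). ennreal (exp (- (1 / real (Suc i)) * (norm (\<xi> - 0))\<^sup>2))"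
  have lim: "(\<lambda>i. ?u i \<xi>) \<longlonglongrightarrow> 1" for \<xi>
  proof -
    have "(\<lambda>i. exp (- (1 / real (Suc i)) * (norm (\<xi> - 0))\<^sup>2)) \<longlonglongrightarrow> exp (- 0 * (norm (\<xi> - 0))\<^sup>2)"
      by (intro tendsto_intros LIMSEQ_inverse_real_of_nat[unfolded inverse_eq_divide])
    then show ?thesis using tendsto_ennrealI by fastforce
  qed
  have "emeasure \<mu> UNIV = (\<integral>\<^sup>+\<xi>. liminf (\<lambda>i. ?u i \<xi>) \<partial>\<mu>)"
    using lim_imp_Liminf[OF sequentially_bot lim] space by simp
  also have "\<dots> \<le> liminf (\<lambda>i. \<integral>\<^sup>+\<xi>. ?u i \<xi> \<partial>\<mu>)"
    by (rule nn_integral_liminf) measurable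
  also have "\<dots> = liminf (\<lambda>i. \<integral>\<^sup>+\<xi>. ?u i \<xi> \<partial>\<nu>)"
    by (intro arg_cong[where f = liminf] ext has_fourier_transform_gaussian_eq[OF \<mu> \<nu>]) simp
  also have "\<dots> \<le> liminf (\<lambda>i::nat. emeasure \<nu> UNIV)"
  proof (intro Liminf_mono always_eventually allI)
    fix i
    have "(\<integral>\<^sup>+\<xi>. ?u i \<xi> \<partial>\<nu>) \<le> (\<integral>\<^sup>+\<xi>. 1 \<partial>\<nu>)"
      by (intro nn_integral_mono) (auto simp: ennreal_1[symmetric] simp del: ennreal_1 intro!: ennreal_leI)
    then show "(\<integral>\<^sup>+\<xi>. ?u i \<xi> \<partial>\<nu>) \<le> emeasure \<nu> UNIV" using space by simp
  qed
  also have "\<dots> < \<infinity>" by (simp add: Liminf_const emeasure_eq_measure)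
  finally have "finite_measure \<mu>"
    using space by (intro finite_measureI) simp
  then show ?thesis
    by (rule finite_measure_eqI_gaussian[OF _ \<open>finite_measure \<nu>\<close> sets has_fourier_transform_gaussian_eq[OF \<mu> \<nu>]])
qed

text \<open>\<open>q\<close> is the real part of the inverse Fourier transform, equal to it because
  the values are non-negative reals. \<open>M\<close> is the Schwartz bound of order 0.\<close>

lemma schwartz_pos_def_density:
  fixes \<rho> :: "'a::euclidean_space \<Rightarrow> real"
  assumes "schwartz \<rho>" "\<And>x. 0 \<le> \<rho> x"
    and inv: "\<And>\<xi>. inverse_fourier (\<lambda>x. complex_of_real (\<rho> x)) \<xi> \<in> \<real>\<^sub>\<ge>\<^sub>0"
  obtains q M where "pos_def_density \<rho> q M"
proof -
  obtain M where M: "\<And>x. norm x ^ 0 * norm (\<rho> x) \<le> M" using schwartz_bounded[OF assms(1)] by blast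
  show ?thesis
  proof (rule that, unfold_locales)
    show "\<rho> x \<le> M" for x using M[of x] by simp
    show "inverse_fourier (\<lambda>x. complex_of_real (\<rho> x)) \<xi> =
        complex_of_real (Re (inverse_fourier (\<lambda>x. complex_of_real (\<rho> x)) \<xi>))"
      "0 \<le> Re (inverse_fourier (\<lambda>x. complex_of_real (\<rho> x)) \<xi>)" for \<xi>
      using inv[of \<xi>] by (auto simp: complex_nonneg_Reals_iff complex_eq_iff)
  qed (use assms schwartz_integrable in auto)
qed

section \<open>Identification of the spectral measure in dimension three\<close>

theorem proposition5p1:
  fixes \<beta> \<gamma> :: real
    and \<rho> f :: "real ^ 3 \<Rightarrow> real"
    and \<mu> :: "(real ^ 3) measure"
  assumes "0 < \<beta>" and "\<beta> < 3"
    and "schwartz \<rho>"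
    and "\<And>x. 0 \<le> \<rho> x"
    and "\<And>\<xi>. inverse_fourier (\<lambda>x. complex_of_real (\<rho> x)) \<xi> \<in> \<real>\<^sub>\<ge>\<^sub>0"
    and "f = convolve \<rho> (\<lambda>y. 1 / norm y powr \<beta>)"
    and "is_spectral_measure \<mu> f"
    and "0 < \<gamma>" and "\<gamma> < min ((3 - \<beta>) / 2) 1"
  shows "(\<exists>g::real ^ 3 \<Rightarrow> real.
            (\<forall>x. 0 \<le> g x) \<and> locally_integrable g \<and>
            has_fourier_transform
              (density \<mu> (\<lambda>\<zeta>. ennreal (norm \<zeta> powr (2 * \<gamma>))))
              (\<lambda>x. complex_of_real (g x)))
       \<and> (\<integral>\<^sup>+ \<zeta>. ennreal (1 / (1 + norm \<zeta> powr (2 - 2 * \<gamma>))) \<partial>\<mu>) < \<infinity>"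
proof -
  obtain q M where "pos_def_density \<rho> q M"
    using schwartz_pos_def_density[OF assms(3-5)] .
  then interpret pos_def_density \<rho> q M .
  \<comment> \<open>The order for which the Riesz kernel has exponent
    \<open>3 - 2 * a = \<beta>\<close>.\<close>
  define a where "a = (3 - \<beta>) / 2"
  have dim: "real DIM(real ^ 3) = 3" by simp
  have a: "0 < a" "2 * a < real DIM(real ^ 3)" and exponent: "real DIM(real ^ 3) - 2 * a = \<beta>"
    unfolding dim using assms(1,2) by (auto simp: a_def field_simps)
  \<comment> \<open>Positivity is the hypothesis \<open>\<gamma> < (3 - \<beta>) / 2\<close>; the
    upper bound follows from \<open>0 < \<beta>\<close> and \<open>0 < \<gamma>\<close>.\<close>
  have a': "0 < a - \<gamma>" "2 * (a - \<gamma>) < real DIM(real ^ 3)"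
    using assms(1,8,9) unfolding dim by (auto simp: a_def field_simps)
  obtain C where C: "0 < C" and FT: "\<And>c x. 0 \<le> c \<Longrightarrow> (\<integral>\<xi>. iexp (- (x \<bullet> \<xi>)) \<partial>riesz_measure c a) =
    complex_of_real (c * C * convolve \<rho> (\<lambda>y. 1 / norm y powr \<beta>) x)"
    using fourier_riesz_measure[OF a] unfolding exponent by blast
  obtain C' where C': "0 < C'" and FT': "\<And>c x. 0 \<le> c \<Longrightarrow> (\<integral>\<xi>. iexp (- (x \<bullet> \<xi>)) \<partial>riesz_measure c (a - \<gamma>)) =
    complex_of_real (c * C' * convolve \<rho> (\<lambda>y. 1 / norm y powr (real DIM(real ^ 3) - 2 * (a - \<gamma>))) x)"
    using fourier_riesz_measure[OF a'] by blast
  \<comment> \<open>The weight \<open>1 / C\<close> makes the Fourier transform equal to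
    \<open>f\<close> itself.\<close>
  have c: "0 \<le> 1 / C" using C by simp
  have fin: "finite_measure (riesz_measure (1 / C) a)" "finite_measure (riesz_measure (1 / C) (a - \<gamma>))"
    using finite_riesz_measure a a' c by blast+
  have "(\<integral>\<xi>. iexp (- (x \<bullet> \<xi>)) \<partial>riesz_measure (1 / C) a) = complex_of_real (f x)" for x
    unfolding FT[OF c] assms(6) using C by simp
  then have "has_fourier_transform (riesz_measure (1 / C) a) (\<lambda>x. complex_of_real (f x))"
    by (rule has_fourier_transform_finite_measure(1)[OF fin(1) sets_riesz_measure])
  then have \<mu>: "\<mu> = riesz_measure (1 / C) a"
    using assms(7) fin(1) unfolding is_spectral_measure_def by (intro has_fourier_transform_unique)
  \<comment> \<open>Up to a positive constant this is the potential of \<open>\<rho>\<close> with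
    exponent \<open>\<beta> + 2 * \<gamma>\<close>.\<close>
  define g where "g x = 1 / C * C' * convolve \<rho> (\<lambda>y. 1 / norm y powr (real DIM(real ^ 3) - 2 * (a - \<gamma>))) x" for x
  have "density \<mu> (\<lambda>\<zeta>. ennreal (norm \<zeta> powr (2 * \<gamma>))) = riesz_measure (1 / C) (a - \<gamma>)"
    unfolding \<mu> by (rule density_riesz_measure[OF c])
  then have "locally_integrable g" "has_fourier_transform
      (density \<mu> (\<lambda>\<zeta>. ennreal (norm \<zeta> powr (2 * \<gamma>)))) (\<lambda>x. complex_of_real (g x))"
    using has_fourier_transform_finite_measure[OF fin(2) sets_riesz_measure, of g] FT'[OF c]
    by (auto simp: g_def)
  moreover have "0 \<le> g x" for x
    unfolding g_def convolve_def using C C' assms(4) by (intro mult_nonneg_nonneg integral_nonneg_AE) auto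
  \<comment> \<open>The integrand is at most 1 and \<open>\<mu>\<close> has been identified as a
    finite measure, so its total mass bounds the integral.\<close>
  moreover have "(\<integral>\<^sup>+ \<zeta>. ennreal (1 / (1 + norm \<zeta> powr (2 - 2 * \<gamma>))) \<partial>\<mu>) \<le> (\<integral>\<^sup>+ \<zeta>. 1 \<partial>\<mu>)"
    by (intro nn_integral_mono) (auto simp: ennreal_1[symmetric] divide_simps add_pos_nonneg simp del: ennreal_1 intro!: ennreal_leI)
  then have "(\<integral>\<^sup>+ \<zeta>. ennreal (1 / (1 + norm \<zeta> powr (2 - 2 * \<gamma>))) \<partial>\<mu>) < \<infinity>"
    using finite_measure.emeasure_finite[OF fin(1)] by (simp add: \<mu> less_top order.strict_trans1)
  ultimately show ?thesis by blast
qed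

end
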